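(* Let $\Gamma$ be a group equipped with a linear representation $\rho:\Gamma\to GL(\mathbb{F}^d)$ over a field $\mathbb{F}$, and let $(G=(V,E),\psi)$ be a finite $\Gamma$-gain graph. Then for every $F\subseteq E$, the rank over $\mathbb{K}$ of the family $\{x_{e,\psi}\mid e\in F\}$ equals $$f_\rho^{\mathbf 1}(F):=\min\{|F\setminus X|+f_\rho(X)\mid X\subseteq F\}.$$ That is, $f_\rho^{\mathbf 1}$ is the rank function of the linear matroid on $E$ represented by $e\mapsto x_{e,\psi}$.
   Context: A $\Gamma$-gain graph $(G,\psi)$: $G=(V,E)$ a finite directed graph (loops, parallel edges allowed), $\psi:E\to\Gamma$, reversing an edge inverts its gain. The gain of a walk is the product of its edge gains in order, with $\psi(e)^{-1}$ for backward edges. For $X\subseteq E$, $v\in V$, $\langle X\rangle_{\psi,v}$ is the subgroup of gains of closed walks at $v$ using only edges of $X$. For $F\subseteq E$: $V(F)$ = endvertices of $F$; $C(F)$ = partition of $F$ into edge sets of connected components of $(V(F),F)$; $c(F)=|C(F)|$. $d_\rho(X)=\dim_{\mathbb{F}}\operatorname{span}\{\operatorname{image}(I_d-\rho(\gamma))\mid\gamma\in X\}$ for $X\subseteq\Gamma$; for connected $X\subseteq E$, $d_\rho\langle X\rangle=d_\rho(\langle X\rangle_{\psi,v})$ for any $v\in V(X)$; $f_\rho(F)=d|V(F)|-d\,c(F)+\sum_{X\in C(F)}d_\rho\langle X\rangle$. Let $\mathbb{K}\supseteq\mathbb{F}$ be a field containing elements $\{\alpha_e^i: e\in E,1\le i\le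 d\}$ algebraically independent over $\mathbb{F}$, and $\alpha_e=(\alpha_e^1,\dots,\alpha_e^d)^\top\in\mathbb{K}^d$. Define $x_{e,\psi}\in(\mathbb{K}^d)^V$: for a non-loop edge $e$ from $i$ to $j$, $x_{e,\psi}(i)=-\rho(\psi(e))\alpha_e$, $x_{e,\psi}(j)=\alpha_e$, and $x_{e,\psi}(v)=0$ otherwise; for a loop $e$ at $i$, $x_{e,\psi}(i)=(I_d-\rho(\psi(e)))\alpha_e$ and $x_{e,\psi}(v)=0$ otherwise. *)

theory Defs
  imports "HOL-Analysis.Analysis" "HOL-Algebra.Group" "HOL-Library.Poly_Mapping"
    "HOL-Library.Function_Algebras"
    "Graph_Theory.Digraph"
begin

section \<open>Linear representations\<close>

definition GL :: "('f::field ^ 'd ^ 'd) monoid" where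
  "GL = \<lparr>carrier = {A. invertible A}, monoid.mult = (**), one = mat 1\<rparr>"

definition rep_dim :: "('g \<Rightarrow> 'f::field ^ 'd ^ 'd) \<Rightarrow> 'g set \<Rightarrow> nat" where
  "rep_dim \<rho> X = vec.dim (vec.span (\<Union>\<gamma>\<in>X. range (\<lambda>y. (mat 1 - \<rho> \<gamma>) *v y)))"

section \<open>Walks in gain graphs\<close>

text \<open>
  A gain graph is a directed multigraph \<open>G\<close> together with a map \<open>\<psi>\<close> from its arcs to the group.
  Walks ignore the orientation of the edges. They are lists of steps, a step being an edge with
  a flag that is \<open>True\<close> if the edge is traversed from its tail to its head and \<open>False\<close>
  if it is traversed backwards. In particular a loop can be traversed in two ways.
\<close>

fun step_src :: "('v, 'e) pre_digraph \<Rightarrow> 'e \<times> bool \<Rightarrow> 'v" where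
  "step_src G (e, b) = (if b then tail G e else head G e)"

fun step_dst :: "('v, 'e) pre_digraph \<Rightarrow> 'e \<times> bool \<Rightarrow> 'v" where
  "step_dst G (e, b) = (if b then head G e else tail G e)"

fun step_gain :: "('g, 'm) monoid_scheme \<Rightarrow> ('e \<Rightarrow> 'g) \<Rightarrow> 'e \<times> bool \<Rightarrow> 'g" where
  "step_gain \<Gamma> \<psi> (e, b) = (if b then \<psi> e else inv\<^bsub>\<Gamma>\<^esub> (\<psi> e))"

primrec is_walk ::
    "('v, 'e) pre_digraph \<Rightarrow> 'e set \<Rightarrow> 'v \<Rightarrow> ('e \<times> bool) list \<Rightarrow> 'v \<Rightarrow> bool" where
  "is_walk G X u [] w \<longleftrightarrow> u = w"
| "is_walk G X u (s # p) w \<longleftrightarrow> fst s \<in> X \<and> step_src G s = u \<and> is_walk G X (step_dst G s) p w"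

primrec walk_gain ::
    "('g, 'm) monoid_scheme \<Rightarrow> ('e \<Rightarrow> 'g) \<Rightarrow> ('e \<times> bool) list \<Rightarrow> 'g" where
  "walk_gain \<Gamma> \<psi> [] = \<one>\<^bsub>\<Gamma>\<^esub>"
| "walk_gain \<Gamma> \<psi> (s # p) = step_gain \<Gamma> \<psi> s \<otimes>\<^bsub>\<Gamma>\<^esub> walk_gain \<Gamma> \<psi> p"

definition gain_group ::
    "('g, 'm) monoid_scheme \<Rightarrow> ('v, 'e) pre_digraph \<Rightarrow> ('e \<Rightarrow> 'g) \<Rightarrow> 'e set \<Rightarrow> 'v \<Rightarrow> 'g set" where
  "gain_group \<Gamma> G \<psi> X v = {walk_gain \<Gamma> \<psi> p | p. is_walk G X v p v}"

section \<open>Connected components of edge sets\<close>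

definition end_verts :: "('v, 'e) pre_digraph \<Rightarrow> 'e set \<Rightarrow> 'v set" where
  "end_verts G F = tail G ` F \<union> head G ` F"

definition vertex_components :: "('v, 'e) pre_digraph \<Rightarrow> 'e set \<Rightarrow> 'v set set" where
  "vertex_components G F =
     end_verts G F // {(u, w). u \<in> end_verts G F \<and> w \<in> end_verts G F \<and> (\<exists>p. is_walk G F u p w)}"

definition edge_components :: "('v, 'e) pre_digraph \<Rightarrow> 'e set \<Rightarrow> 'e set set" where
  "edge_components G F =
     {{e \<in> F. tail G e \<in> K \<and> head G e \<in> K} | K. K \<in> vertex_components G F}"

section \<open>The functions $f_\rho$ and $f_\rho^{\mathbf 1}$\<close>

definition conn_rep_dim ::
    "('g, 'm) monoid_scheme \<Rightarrow> ('g \<Rightarrow> 'f::field ^ 'd ^ 'd) \<Rightarrow> ('v, 'e) pre_digraph \<Rightarrow> ('e \<Rightarrow> 'g)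
      \<Rightarrow> 'e set \<Rightarrow> nat" where
  "conn_rep_dim \<Gamma> \<rho> G \<psi> X = rep_dim \<rho> (gain_group \<Gamma> G \<psi> X (SOME v. v \<in> end_verts G X))"

text \<open>
  The choice of the base vertex in \<open>conn_rep_dim\<close> is irrelevant: moving it along a walk
  conjugates the group of gains of closed walks.
\<close>

lemma is_walk_append:
  "is_walk G X u (p @ q) w \<longleftrightarrow> (\<exists>v. is_walk G X u p v \<and> is_walk G X v q w)"
  by (induction p arbitrary: u) auto

lemma is_walk_rev:
  "is_walk G X u p w \<Longrightarrow> is_walk G X w (rev (map (\<lambda>(e, b). (e, \<not> b)) p)) u"
  by (induction p arbitrary: u) (auto simp: is_walk_append split: if_splits)

context
  fixes \<Gamma> :: "('g, 'm) monoid_scheme" and G :: "('v, 'e) pre_digraph" and \<psi> :: "'e \<Rightarrow> 'g"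
    and X :: "'e set"
  assumes grp: "group \<Gamma>" and psi: "\<psi> \<in> X \<rightarrow> carrier \<Gamma>"
begin

interpretation group \<Gamma> by (rule grp)

lemma step_gain_closed: "fst s \<in> X \<Longrightarrow> step_gain \<Gamma> \<psi> s \<in> carrier \<Gamma>"
  using psi by (cases s) (auto simp: Pi_iff)

lemma walk_gain_closed: "is_walk G X u p w \<Longrightarrow> walk_gain \<Gamma> \<psi> p \<in> carrier \<Gamma>"
  by (induction p arbitrary: u) (auto intro: step_gain_closed simp del: step_gain.simps)

lemma walk_gain_append:
  "is_walk G X u p v \<Longrightarrow> is_walk G X v q w \<Longrightarrow>
     walk_gain \<Gamma> \<psi> (p @ q) = walk_gain \<Gamma> \<psi> p \<otimes>\<^bsub>\<Gamma>\<^esub> walk_gain \<Gamma> \<psi> q"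
  by (induction p arbitrary: u)
    (auto simp: m_assoc walk_gain_closed step_gain_closed simp del: step_gain.simps)

lemma walk_gain_rev:
  "is_walk G X u p w \<Longrightarrow>
     walk_gain \<Gamma> \<psi> (rev (map (\<lambda>(e, b). (e, \<not> b)) p)) = inv\<^bsub>\<Gamma>\<^esub> (walk_gain \<Gamma> \<psi> p)"
proof (induction p arbitrary: u)
  case (Cons s p)
  obtain e b where s: "s = (e, b)" by (cases s)
  from Cons.prems have p: "is_walk G X (step_dst G s) p w" and e: "e \<in> X"
    by (auto simp: s)
  have "is_walk G X (step_dst G s) [(e, \<not> b)] (step_src G s)"
    using e by (auto simp: s)
  from walk_gain_append[OF is_walk_rev[OF p] this] Cons.IH[OF p]
  have "walk_gain \<Gamma> \<psi> (rev (map (\<lambda>(e, b). (e, \<not> b)) (s # p))) =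
      inv\<^bsub>\<Gamma>\<^esub> (walk_gain \<Gamma> \<psi> p) \<otimes>\<^bsub>\<Gamma>\<^esub> (step_gain \<Gamma> \<psi> (e, \<not> b) \<otimes>\<^bsub>\<Gamma>\<^esub> \<one>\<^bsub>\<Gamma>\<^esub>)"
    by (simp add: s)
  also have "step_gain \<Gamma> \<psi> (e, \<not> b) \<otimes>\<^bsub>\<Gamma>\<^esub> \<one>\<^bsub>\<Gamma>\<^esub> = inv\<^bsub>\<Gamma>\<^esub> (step_gain \<Gamma> \<psi> s)"
    using psi e by (auto simp: s Pi_iff)
  finally show ?case
    using walk_gain_closed[OF p] step_gain_closed[of s] e by (simp add: s inv_mult_group del: step_gain.simps)
qed simp

lemma gain_group_subset: "gain_group \<Gamma> G \<psi> X v \<subseteq> carrier \<Gamma>"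
  by (auto simp: gain_group_def intro: walk_gain_closed)

lemma gain_group_conj:
  assumes p: "is_walk G X u p w" and g: "g = walk_gain \<Gamma> \<psi> p" and h: "h \<in> gain_group \<Gamma> G \<psi> X w"
  shows "g \<otimes>\<^bsub>\<Gamma>\<^esub> h \<otimes>\<^bsub>\<Gamma>\<^esub> inv\<^bsub>\<Gamma>\<^esub> g \<in> gain_group \<Gamma> G \<psi> X u"
proof -
  from h obtain q where q: "is_walk G X w q w" "h = walk_gain \<Gamma> \<psi> q"
    by (auto simp: gain_group_def)
  define r where "r = rev (map (\<lambda>(e, b). (e, \<not> b)) p)"
  have r: "is_walk G X w r u" unfolding r_def by (rule is_walk_rev[OF p])
  have pq: "is_walk G X u (p @ q) w" using p q by (auto simp: is_walk_append)
  have "walk_gain \<Gamma> \<psi> ((p @ q) @ r) = g \<otimes>\<^bsub>\<Gamma>\<^esub> h \<otimes>\<^bsub>\<Gamma>\<^esub> inv\<^bsub>\<Gamma>\<^esub> g"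
    unfolding walk_gain_append[OF pq r] walk_gain_append[OF p q(1)]
    by (simp add: r_def walk_gain_rev[OF p] g q(2))
  moreover have "is_walk G X u ((p @ q) @ r) u"
    using pq r unfolding is_walk_append[of G X u "p @ q" r u] by blast
  ultimately show ?thesis unfolding gain_group_def mem_Collect_eq by metis
qed

lemma rep_dim_gain_group_le:
  assumes rho: "\<rho> \<in> hom \<Gamma> GL" and p: "is_walk G X u p w"
  shows "rep_dim \<rho> (gain_group \<Gamma> G \<psi> X w) \<le> rep_dim \<rho> (gain_group \<Gamma> G \<psi> X u)"
proof -
  define g where "g = walk_gain \<Gamma> \<psi> p"
  have gc: "g \<in> carrier \<Gamma>" unfolding g_def by (rule walk_gain_closed[OF p])
  let ?S = "\<lambda>v. \<Union>\<gamma>\<in>gain_group \<Gamma> G \<psi> X v. range (\<lambda>y. (mat 1 - \<rho> \<gamma>) *v y)"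
  have mult: "\<rho> (a \<otimes>\<^bsub>\<Gamma>\<^esub> b) = \<rho> a ** \<rho> b" if "a \<in> carrier \<Gamma>" "b \<in> carrier \<Gamma>" for a b
    using hom_mult[OF rho that] by (simp add: GL_def)
  have "invertible (\<rho> g)"
    using hom_in_carrier[OF rho gc] by (simp add: GL_def)
  then have inj: "inj ((*v) (\<rho> g))"
    by (simp add: inj_matrix_vector_mult)
  have sub: "(*v) (\<rho> g) ` ?S w \<subseteq> ?S u"
  proof
    fix z assume "z \<in> (*v) (\<rho> g) ` ?S w"
    then obtain h y where h: "h \<in> gain_group \<Gamma> G \<psi> X w" and z: "z = \<rho> g *v ((mat 1 - \<rho> h) *v y)"
      by auto
    have hc: "h \<in> carrier \<Gamma>" using h gain_group_subset by blast
    define k where "k = g \<otimes>\<^bsub>\<Gamma>\<^esub> h \<otimes>\<^bsub>\<Gamma>\<^esub> inv\<^bsub>\<Gamma>\<^esub> g"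
    have kc: "k \<in> carrier \<Gamma>" using gc hc by (simp add: k_def)
    have k: "k \<in> gain_group \<Gamma> G \<psi> X u"
      unfolding k_def by (rule gain_group_conj[OF p g_def h])
    have "k \<otimes>\<^bsub>\<Gamma>\<^esub> g = g \<otimes>\<^bsub>\<Gamma>\<^esub> h" using gc hc by (simp add: k_def m_assoc)
    then have "\<rho> k ** \<rho> g = \<rho> g ** \<rho> h" using mult gc hc kc by metis
    then have "\<rho> k *v (\<rho> g *v y) = \<rho> g *v (\<rho> h *v y)"
      by (simp add: matrix_vector_mul_assoc)
    then have "z = (mat 1 - \<rho> k) *v (\<rho> g *v y)"
      by (simp add: z matrix_vector_mult_diff_rdistrib vec.diff)
    then show "z \<in> ?S u" using k by blast
  qed
  have "vec.dim (?S w) = vec.dim ((*v) (\<rho> g) ` ?S w)"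
    by (rule vec.dim_image_eq[symmetric]) (auto intro: inj_on_subset[OF inj])
  also have "\<dots> \<le> vec.dim (?S u)" by (rule vec.dim_subset[OF sub])
  finally show ?thesis by (simp add: rep_dim_def)
qed

end

lemma conn_rep_dim_eq:
  assumes "group \<Gamma>" "\<psi> \<in> X \<rightarrow> carrier \<Gamma>" "\<rho> \<in> hom \<Gamma> GL" "v \<in> end_verts G X"
    and conn: "\<And>u w. u \<in> end_verts G X \<Longrightarrow> w \<in> end_verts G X \<Longrightarrow> \<exists>p. is_walk G X u p w"
  shows "conn_rep_dim \<Gamma> \<rho> G \<psi> X = rep_dim \<rho> (gain_group \<Gamma> G \<psi> X v)"
proof -
  define u where "u = (SOME v. v \<in> end_verts G X)"
  have "u \<in> end_verts G X" unfolding u_def using assms(4) by (rule someI)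
  with conn[of u v] conn[of v u] assms(4) show ?thesis
    unfolding conn_rep_dim_def u_def[symmetric]
    by (metis rep_dim_gain_group_le[OF assms(1-3)] order_antisym)
qed

definition f_rho ::
    "('g, 'm) monoid_scheme \<Rightarrow> ('g \<Rightarrow> 'f::field ^ 'd ^ 'd) \<Rightarrow> ('v, 'e) pre_digraph \<Rightarrow> ('e \<Rightarrow> 'g)
      \<Rightarrow> 'e set \<Rightarrow> int" where
  "f_rho \<Gamma> \<rho> G \<psi> F =
     int CARD('d) * int (card (end_verts G F)) - int CARD('d) * int (card (edge_components G F))
     + (\<Sum>X\<in>edge_components G F. int (conn_rep_dim \<Gamma> \<rho> G \<psi> X))"

definition f_rho_1 ::
    "('g, 'm) monoid_scheme \<Rightarrow> ('g \<Rightarrow> 'f::field ^ 'd ^ 'd) \<Rightarrow> ('v, 'e) pre_digraph \<Rightarrow> ('e \<Rightarrow> 'g)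
      \<Rightarrow> 'e set \<Rightarrow> int" where
  "f_rho_1 \<Gamma> \<rho> G \<psi> F = Min {int (card (F - X)) + f_rho \<Gamma> \<rho> G \<psi> X | X. X \<subseteq> F}"

section \<open>Generic vectors over an extension field\<close>

text \<open>
  An extension field is given by a ring homomorphism \<open>\<iota>\<close> between fields, which is injective.
\<close>

definition field_extension :: "('f::field \<Rightarrow> 'k::field) \<Rightarrow> bool" where
  "field_extension \<iota> \<longleftrightarrow> \<iota> 1 = 1 \<and> (\<forall>x y. \<iota> (x + y) = \<iota> x + \<iota> y) \<and> (\<forall>x y. \<iota> (x * y) = \<iota> x * \<iota> y)"

text \<open>
  Multivariate polynomials over the base field in the indeterminates \<open>'i\<close> are finitely supported
  maps from monomials (finitely supported exponent maps) to coefficients.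
\<close>

definition mpoly_eval ::
    "('f::field \<Rightarrow> 'k::field) \<Rightarrow> ('i \<Rightarrow> 'k) \<Rightarrow> (('i \<Rightarrow>\<^sub>0 nat) \<Rightarrow>\<^sub>0 'f) \<Rightarrow> 'k" where
  "mpoly_eval \<iota> a P =
     (\<Sum>m\<in>Poly_Mapping.keys P. \<iota> (Poly_Mapping.lookup P m) *
        (\<Prod>i\<in>Poly_Mapping.keys m. a i ^ Poly_Mapping.lookup m i))"

definition algebraically_independent ::
    "('f::field \<Rightarrow> 'k::field) \<Rightarrow> 'i set \<Rightarrow> ('i \<Rightarrow> 'k) \<Rightarrow> bool" where
  "algebraically_independent \<iota> I a \<longleftrightarrow>
     (\<forall>P :: ('i \<Rightarrow>\<^sub>0 nat) \<Rightarrow>\<^sub>0 'f.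
        (\<forall>m\<in>Poly_Mapping.keys P. Poly_Mapping.keys m \<subseteq> I) \<longrightarrow> mpoly_eval \<iota> a P = 0 \<longrightarrow> P = 0)"

definition edge_vec ::
    "('f::field \<Rightarrow> 'k::field) \<Rightarrow> ('g \<Rightarrow> 'f ^ 'd ^ 'd) \<Rightarrow> ('v, 'e) pre_digraph \<Rightarrow> ('e \<Rightarrow> 'g)
      \<Rightarrow> ('e \<Rightarrow> 'k ^ 'd) \<Rightarrow> 'e \<Rightarrow> 'v \<Rightarrow> 'k ^ 'd" where
  "edge_vec \<iota> \<rho> G \<psi> \<alpha> e v =
     (let R = map_matrix \<iota> (\<rho> (\<psi> e)) in
      if tail G e = head G e then
        (if v = tail G e then (mat 1 - R) *v \<alpha> e else 0)
      else if v = tail G e then - (R *v \<alpha> e)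
      else if v = head G e then \<alpha> e
      else 0)"

section \<open>Linear matroids\<close>

definition fun_scale :: "'k::field \<Rightarrow> ('v \<Rightarrow> 'k ^ 'd) \<Rightarrow> 'v \<Rightarrow> 'k ^ 'd" where
  "fun_scale c x = (\<lambda>v. c *s x v)"

lemma vector_space_fun_scale: "vector_space fun_scale"
  by unfold_locales (auto simp: fun_scale_def fun_eq_iff vec_eq_iff algebra_simps)

definition family_rank :: "('e \<Rightarrow> 'v \<Rightarrow> 'k::field ^ 'd) \<Rightarrow> 'e set \<Rightarrow> nat" where
  "family_rank x F = vector_space.dim fun_scale (module.span fun_scale (x ` F))"

definition family_independent :: "('e \<Rightarrow> 'v \<Rightarrow> 'k::field ^ 'd) \<Rightarrow> 'e set \<Rightarrow> bool" where
  "family_independent x I \<longleftrightarrow> inj_on x I \<and> \<not> module.dependent fun_scale (x ` I)"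

definition matroid_rank :: "('e set \<Rightarrow> bool) \<Rightarrow> 'e set \<Rightarrow> nat" where
  "matroid_rank indep F = Max (card ` {I. I \<subseteq> F \<and> indep I})"

end

theory Submission
  imports Defs
begin

text \<open>
  Over \<open>K\<close>, the vector \<open>x e\<close> is a generic element of the subspace \<open>U e\<close> of all vectors obtained by
  replacing \<open>\<alpha> e\<close> with an arbitrary \<open>y\<close>. If \<open>x e\<close> lies in the span of other vectors \<open>x f\<close>, then so
  does all of \<open>U e\<close>, because the linear forms cutting out that span do not involve the coordinates
  of \<open>\<alpha> e\<close>. Deleting one by one those edges of \<open>F\<close> that lower the rank leaves a set \<open>X\<close> with
  \<open>rank F = |F - X| + dim (\<Sum>e\<in>X. U e)\<close>, while \<open>\<le>\<close> holds for every \<open>X\<close>. Finally,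
  \<open>dim (\<Sum>e\<in>X. U e) = f_rho X\<close>: the form \<open>x \<mapsto> \<Sum>v. \<rho> (g v) x v\<close>, with \<open>g v\<close> the gain of a path from the
  root of a component to \<open>v\<close>, maps the part of the sum on that component onto the span of the images
  of \<open>1 - \<rho> \<gamma>\<close>, \<open>\<gamma>\<close> ranging over the gains of closed walks at the root.
\<close>

section \<open>Values of polynomials\<close>

text \<open>A subring and not a subfield: the set it is meant for consists of values of polynomials,
  so the elimination carried out over it has to avoid division.\<close>

locale field_subring =
  fixes R :: "'k::field set"
  assumes one: "1 \<in> R"
    and diff: "x \<in> R \<Longrightarrow> y \<in> R \<Longrightarrow> x - y \<in> R"
    and mult: "x \<in> R \<Longrightarrow> y \<in> R \<Longrightarrow> x * y \<in> R"
begin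

lemma zero: "0 \<in> R"
  using diff[OF one one] by simp

lemma uminus: "x \<in> R \<Longrightarrow> - x \<in> R"
  using diff[OF zero] by fastforce

lemma add: "x \<in> R \<Longrightarrow> y \<in> R \<Longrightarrow> x + y \<in> R"
  using diff[OF _ uminus] by fastforce

lemma sum: "(\<And>i. i \<in> A \<Longrightarrow> f i \<in> R) \<Longrightarrow> sum f A \<in> R"
  by (induction A rule: infinite_finite_induct) (auto intro: zero add)

end

lemma field_extension_simps:
  assumes "field_extension \<iota>"
  shows "\<iota> 1 = 1" "\<iota> 0 = 0" "\<iota> (x + y) = \<iota> x + \<iota> y" "\<iota> (x * y) = \<iota> x * \<iota> y"
    "\<iota> (- x) = - \<iota> x" "\<iota> (x - y) = \<iota> x - \<iota> y"
proof -
  have add: "\<iota> (x + y) = \<iota> x + \<iota> y" for x y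
    using assms by (simp add: field_extension_def)
  show "\<iota> 1 = 1" "\<iota> (x + y) = \<iota> x + \<iota> y" "\<iota> (x * y) = \<iota> x * \<iota> y"
    using assms by (auto simp: field_extension_def)
  show 0: "\<iota> 0 = 0" using add[of 0 0] by (metis add_0 add_left_cancel add_0_right)
  show m: "\<iota> (- x) = - \<iota> x" for x using add[of x "- x"] 0 by (simp add: minus_unique)
  show "\<iota> (x - y) = \<iota> x - \<iota> y" using add[of x "- y"] m by simp
qed

lemma field_extension_sum:
  assumes "field_extension \<iota>"
  shows "\<iota> (sum f A) = (\<Sum>i\<in>A. \<iota> (f i))"
  by (induction A rule: infinite_finite_induct) (auto simp: field_extension_simps[OF assms])

section \<open>Evaluation of monomials and polynomials\<close>

definition mono_val :: "('i \<Rightarrow> 'k::field) \<Rightarrow> ('i \<Rightarrow>\<^sub>0 nat) \<Rightarrow> 'k" where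
  "mono_val a m = (\<Prod>i\<in>Poly_Mapping.keys m. a i ^ Poly_Mapping.lookup m i)"

lemma mono_val_superset:
  assumes "finite K" "Poly_Mapping.keys m \<subseteq> K"
  shows "mono_val a m = (\<Prod>i\<in>K. a i ^ Poly_Mapping.lookup m i)"
  unfolding mono_val_def using assms
  by (intro prod.mono_neutral_left) (auto simp: in_keys_iff)

lemma mono_val_0 [simp]: "mono_val a 0 = 1"
  by (simp add: mono_val_def)

lemma mono_val_single [simp]: "mono_val a (Poly_Mapping.single i (Suc 0)) = a i"
  by (simp add: mono_val_def)

lemma keys_add_nat:
  fixes m n :: "'i \<Rightarrow>\<^sub>0 nat"
  shows "Poly_Mapping.keys (m + n) = Poly_Mapping.keys m \<union> Poly_Mapping.keys n"
  by (auto simp: in_keys_iff lookup_add)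

lemma mono_val_add: "mono_val a (m + n) = mono_val a m * mono_val a n"
proof -
  let ?K = "Poly_Mapping.keys m \<union> Poly_Mapping.keys n"
  have "mono_val a (m + n) = (\<Prod>i\<in>?K. a i ^ Poly_Mapping.lookup (m + n) i)"
    by (rule mono_val_superset) (auto simp: keys_add_nat)
  also have "\<dots> = mono_val a m * mono_val a n"
    by (subst (1 2) mono_val_superset[of ?K]) (auto simp: lookup_add power_add prod.distrib)
  finally show ?thesis .
qed

context
  fixes \<iota> :: "'f::field \<Rightarrow> 'k::field"
  assumes ext: "field_extension \<iota>"
begin

lemma mpoly_eval_superset:
  assumes "finite M" "Poly_Mapping.keys P \<subseteq> M"
  shows "mpoly_eval \<iota> a P = (\<Sum>m\<in>M. \<iota> (Poly_Mapping.lookup P m) * mono_val a m)"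
  unfolding mpoly_eval_def mono_val_def[symmetric] using assms
  by (intro sum.mono_neutral_left) (auto simp: in_keys_iff field_extension_simps[OF ext])

lemma mpoly_eval_add: "mpoly_eval \<iota> a (P + Q) = mpoly_eval \<iota> a P + mpoly_eval \<iota> a Q"
proof -
  let ?M = "Poly_Mapping.keys P \<union> Poly_Mapping.keys Q"
  have "mpoly_eval \<iota> a (P + Q) = (\<Sum>m\<in>?M. \<iota> (Poly_Mapping.lookup (P + Q) m) * mono_val a m)"
    by (rule mpoly_eval_superset) (use Poly_Mapping.keys_add[of P Q] in auto)
  also have "\<dots> = mpoly_eval \<iota> a P + mpoly_eval \<iota> a Q"
    by (subst (1 2) mpoly_eval_superset[of ?M])
      (auto simp: lookup_add field_extension_simps[OF ext] ring_distribs sum.distrib)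
  finally show ?thesis .
qed

lemma mpoly_eval_sum: "mpoly_eval \<iota> a (sum P A) = (\<Sum>i\<in>A. mpoly_eval \<iota> a (P i))"
proof (induction A rule: infinite_finite_induct)
qed (simp_all add: mpoly_eval_add, simp_all add: mpoly_eval_def)

lemma mpoly_eval_single: "mpoly_eval \<iota> a (Poly_Mapping.single m c) = \<iota> c * mono_val a m"
  by (subst mpoly_eval_superset[of "{m}"]) (auto simp: keys_single)

text \<open>This is the subring of the extension field generated by the image of
  \<open>\<iota>\<close> and the elements \<open>a i\<close> with \<open>i\<close> in
  \<open>J\<close>.\<close>

definition poly_values :: "'i set \<Rightarrow> ('i \<Rightarrow> 'k) \<Rightarrow> 'k set" where
  "poly_values J a =
     {mpoly_eval \<iota> a P | P. \<forall>m\<in>Poly_Mapping.keys P. Poly_Mapping.keys m \<subseteq> J}"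

lemma poly_valuesE:
  assumes "x \<in> poly_values J a"
  obtains P where "x = mpoly_eval \<iota> a P"
    "\<And>m. m \<in> Poly_Mapping.keys P \<Longrightarrow> Poly_Mapping.keys m \<subseteq> J"
  using assms by (auto simp: poly_values_def)

lemma poly_values_add:
  assumes "x \<in> poly_values J a" "y \<in> poly_values J a"
  shows "x + y \<in> poly_values J a"
proof -
  obtain P Q where P: "x = mpoly_eval \<iota> a P"
    "\<And>m. m \<in> Poly_Mapping.keys P \<Longrightarrow> Poly_Mapping.keys m \<subseteq> J"
    and Q: "y = mpoly_eval \<iota> a Q"
    "\<And>m. m \<in> Poly_Mapping.keys Q \<Longrightarrow> Poly_Mapping.keys m \<subseteq> J"
    using assms by (metis poly_valuesE)
  have "\<forall>m\<in>Poly_Mapping.keys (P + Q). Poly_Mapping.keys m \<subseteq> J"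
    using P(2) Q(2) Poly_Mapping.keys_add[of P Q] by blast
  then show ?thesis
    unfolding P(1) Q(1) mpoly_eval_add[symmetric] poly_values_def by blast
qed

lemma poly_values_monomial:
  assumes "Poly_Mapping.keys m \<subseteq> J"
  shows "\<iota> c * mono_val a m \<in> poly_values J a"
  unfolding poly_values_def mpoly_eval_single[symmetric] using assms
  by (auto intro!: exI[of _ "Poly_Mapping.single m c"] split: if_splits)

lemma poly_values_const: "\<iota> c \<in> poly_values J a"
  using poly_values_monomial[of 0 J c a] by simp

lemma poly_values_var: "i \<in> J \<Longrightarrow> a i \<in> poly_values J a"
  using poly_values_monomial[of "Poly_Mapping.single i 1" J 1 a]
  by (simp add: field_extension_simps[OF ext])

lemma poly_values_sum:
  "(\<And>i. i \<in> A \<Longrightarrow> f i \<in> poly_values J a) \<Longrightarrow> sum f A \<in> poly_values J a"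
proof (induction A rule: infinite_finite_induct)
qed (auto intro: poly_values_add poly_values_const[of 0, unfolded field_extension_simps[OF ext]])

lemma poly_values_mult:
  assumes "x \<in> poly_values J a" "y \<in> poly_values J a"
  shows "x * y \<in> poly_values J a"
proof -
  obtain P Q where P: "x = mpoly_eval \<iota> a P"
    "\<And>m. m \<in> Poly_Mapping.keys P \<Longrightarrow> Poly_Mapping.keys m \<subseteq> J"
    and Q: "y = mpoly_eval \<iota> a Q"
    "\<And>m. m \<in> Poly_Mapping.keys Q \<Longrightarrow> Poly_Mapping.keys m \<subseteq> J"
    using assms by (metis poly_valuesE)
  have "x * y = (\<Sum>m\<in>Poly_Mapping.keys P. \<Sum>n\<in>Poly_Mapping.keys Q.
      \<iota> (Poly_Mapping.lookup P m * Poly_Mapping.lookup Q n) * mono_val a (m + n))"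
    unfolding P(1) Q(1) mpoly_eval_def mono_val_def[symmetric]
    by (simp add: sum_product mono_val_add field_extension_simps[OF ext] mult_ac)
  also have "\<dots> \<in> poly_values J a"
    by (intro poly_values_sum poly_values_monomial) (auto simp: keys_add_nat dest: P(2) Q(2))
  finally show ?thesis .
qed

lemma field_subring_poly_values: "field_subring (poly_values J a)"
proof
  show "1 \<in> poly_values J a"
    using poly_values_const[of 1] by (simp add: field_extension_simps[OF ext])
  show mult: "x * y \<in> poly_values J a" if "x \<in> poly_values J a" "y \<in> poly_values J a" for x y
    using that by (rule poly_values_mult)
  have "-1 \<in> poly_values J a"
    using poly_values_const[of "-1" J a] by (simp add: field_extension_simps[OF ext])
  from poly_values_add[OF _ poly_values_mult[OF this]]
  show "x - y \<in> poly_values J a" if "x \<in> poly_values J a" "y \<in> poly_values J a" for x y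
    using that by fastforce
qed

text \<open>Lift each \<open>r i\<close> to a polynomial \<open>P i\<close> in the variables
  \<open>J\<close>. The relation is then the value of the sum of the products of \<open>P i\<close>
  with the variable \<open>z i\<close>, a polynomial that must vanish. Each of its monomials
  contains exactly one variable outside \<open>J\<close>, so different summands share no monomial
  and no coefficients cancel.\<close>

lemma algebraically_independent_linear:
  assumes indep: "algebraically_independent \<iota> I a" and JI: "J \<subseteq> I"
    and D: "finite D" "inj_on z D" "z ` D \<subseteq> I - J"
    and r: "\<And>i. i \<in> D \<Longrightarrow> r i \<in> poly_values J a"
    and eq0: "(\<Sum>i\<in>D. a (z i) * r i) = 0" and i0: "i0 \<in> D"
  shows "r i0 = 0"
proof -
  have "\<forall>i\<in>D. \<exists>P. r i = mpoly_eval \<iota> a P \<and>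
      (\<forall>m\<in>Poly_Mapping.keys P. Poly_Mapping.keys m \<subseteq> J)"
    using r by (metis poly_valuesE)
  then obtain P where P: "\<And>i. i \<in> D \<Longrightarrow> r i = mpoly_eval \<iota> a (P i)"
    "\<And>i m. i \<in> D \<Longrightarrow> m \<in> Poly_Mapping.keys (P i) \<Longrightarrow> Poly_Mapping.keys m \<subseteq> J"
    by metis
  define X where "X i = Poly_Mapping.single (z i) (Suc 0)" for i
  define Q where "Q = (\<Sum>i\<in>D. \<Sum>m\<in>Poly_Mapping.keys (P i).
      Poly_Mapping.single (m + X i) (Poly_Mapping.lookup (P i) m))"
  have "mpoly_eval \<iota> a Q = (\<Sum>i\<in>D. a (z i) * r i)"
    unfolding Q_def mpoly_eval_sum mpoly_eval_single mono_val_add X_def mono_val_single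
    by (intro sum.cong refl) (simp add: P(1) mpoly_eval_def mono_val_def sum_distrib_left mult_ac)
  moreover have "Poly_Mapping.keys m \<subseteq> I" if "m \<in> Poly_Mapping.keys Q" for m
  proof -
    have "\<exists>i\<in>D. \<exists>n\<in>Poly_Mapping.keys (P i). m = n + X i"
    proof (rule ccontr)
      assume "\<not> ?thesis"
      then have "Poly_Mapping.lookup Q m = 0"
        unfolding Q_def lookup_sum by (intro sum.neutral ballI) (auto simp: lookup_single when_def)
      with that show False by (simp add: in_keys_iff)
    qed
    then show ?thesis using P(2) JI D(3) by (fastforce simp: keys_add_nat X_def)
  qed
  ultimately have Q0: "Q = 0"
    using indep eq0 by (auto simp: algebraically_independent_def)
  have "Poly_Mapping.lookup (P i0) m0 = 0" for m0
  proof (rule ccontr)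
    assume "Poly_Mapping.lookup (P i0) m0 \<noteq> 0"
    then have m0: "m0 \<in> Poly_Mapping.keys (P i0)" by (simp add: in_keys_iff)
    have iff: "m + X i = m0 + X i0 \<longleftrightarrow> i = i0 \<and> m = m0"
      if "i \<in> D" "m \<in> Poly_Mapping.keys (P i)" for i m
    proof
      assume eq: "m + X i = m0 + X i0"
      \<comment> \<open>The variable \<open>z i0\<close> occurs on the right. On the left it cannot
        come from \<open>m\<close>, whose variables lie in \<open>J\<close>, so it is the variable
        of \<open>X i\<close>.\<close>
      have "z i0 \<notin> Poly_Mapping.keys m" using P(2)[OF that] D(3) i0 by blast
      moreover have "z i0 \<in> Poly_Mapping.keys (m + X i)" unfolding eq
        by (simp add: keys_add_nat X_def)
      ultimately have "z i0 = z i" by (simp add: keys_add_nat X_def)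
      then have "i = i0" using D(2) that i0 by (metis inj_onD)
      with eq show "i = i0 \<and> m = m0" by simp
    qed auto
    have "Poly_Mapping.lookup Q (m0 + X i0) = (\<Sum>i\<in>D. \<Sum>m\<in>Poly_Mapping.keys (P i).
        if i = i0 \<and> m = m0 then Poly_Mapping.lookup (P i) m else 0)"
      unfolding Q_def lookup_sum lookup_single when_def using iff
      by (intro sum.cong refl) auto
    also have "\<dots> = (\<Sum>i\<in>D. if i = i0 then Poly_Mapping.lookup (P i0) m0 else 0)"
      using m0 by (intro sum.cong refl) auto
    also have "\<dots> = Poly_Mapping.lookup (P i0) m0" using D(1) i0 by simp
    finally show False using Q0 \<open>Poly_Mapping.lookup (P i0) m0 \<noteq> 0\<close> by simp
  qed
  then show ?thesis
    using P(1)[OF i0] by (simp add: mpoly_eval_def field_extension_simps[OF ext])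
qed

end

section \<open>Rank of vectors in prescribed subspaces\<close>

context vector_space
begin

text \<open>Finiteness of \<open>W\<close> matters because \<open>dim\<close> is 0 on sets that span
  an infinite-dimensional space.\<close>

lemma dim_mono_finite:
  assumes "V \<subseteq> span W" "finite W"
  shows "dim V \<le> dim W"
proof -
  obtain B where B: "B \<subseteq> W" "independent B" "W \<subseteq> span B" "card B = dim W"
    using basis_exists[of W] by auto
  have "V \<subseteq> span B" using assms(1) span_mono[OF B(3)] by (auto simp: span_span)
  with B show ?thesis using dim_le_card[of V B] finite_subset[OF B(1) assms(2)] by simp
qed

lemma dim_insert_notin_span:
  assumes "finite W" "y \<notin> span W"
  shows "dim (insert y W) = Suc (dim W)"
proof -
  obtain B where B: "B \<subseteq> W" "independent B" "W \<subseteq> span B" "card B = dim W"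
    using basis_exists[of W] by auto
  have sp: "span B = span W" using B(1,3) by (simp add: span_eq span_base subset_iff)
  have "independent (insert y B)"
    using B(2) assms(2) sp by (simp add: independent_insertI)
  moreover have "span (insert y B) = span (insert y W)"
    using sp by (auto simp: span_insert)
  moreover have "y \<notin> B" using assms(2) sp span_base by blast
  moreover have "finite B" using finite_subset[OF B(1) assms(1)] .
  ultimately show ?thesis using B(4) dim_eq_card[of "insert y B" "insert y W"] by simp
qed

context
  fixes x :: "'e \<Rightarrow> 'b" and U :: "'e \<Rightarrow> 'b set" and E :: "'e set"
  assumes finE: "finite E" and finU: "\<And>e. e \<in> E \<Longrightarrow> finite (U e)"
begin

text \<open>A basis of the span of all \<open>U e\<close> with \<open>e\<close> in \<open>X\<close>
  can replace the vectors indexed by \<open>X\<close>; together with the vectors indexed by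
  \<open>F - X\<close> it still spans every \<open>x e\<close>.\<close>

lemma rank_le_subspace_bound:
  assumes mem: "\<And>e. e \<in> E \<Longrightarrow> x e \<in> span (U e)" and F: "F \<subseteq> E" and X: "X \<subseteq> F"
  shows "dim (x ` F) \<le> card (F - X) + dim (\<Union>(U ` X))"
proof -
  obtain B where B: "B \<subseteq> \<Union>(U ` X)" "independent B" "\<Union>(U ` X) \<subseteq> span B"
      "card B = dim (\<Union>(U ` X))"
    using basis_exists by blast
  have fin: "finite F" "finite X" using F X finE by (auto intro: finite_subset)
  have "finite (\<Union>(U ` X))" using fin F X finU by auto
  then have finB: "finite B" using B(1) finite_subset by blast
  have "x e \<in> span (x ` (F - X) \<union> B)" if "e \<in> F" for e
  proof (cases "e \<in> X")
    case True
    have "U e \<subseteq> span B" using True B(3) by auto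
    then have "span (U e) \<subseteq> span B" using span_mono span_span by blast
    also have "\<dots> \<subseteq> span (x ` (F - X) \<union> B)" by (rule span_mono) auto
    finally show ?thesis using mem that F by blast
  qed (use that in \<open>auto intro: span_base\<close>)
  then have "dim (x ` F) \<le> card (x ` (F - X) \<union> B)"
    using fin finB by (intro dim_le_card) auto
  also have "\<dots> \<le> card (F - X) + card B"
    by (rule order_trans[OF card_Un_le]) (use fin in \<open>auto intro: card_image_le\<close>)
  finally show ?thesis using B(4) by simp
qed

text \<open>
  Elements \<open>e\<close> with \<open>x e\<close> outside the span of the others are removed one by one.
  When none is left, genericity puts all of \<open>U e\<close> into the span of the \<open>x e\<close>.
\<close>

lemma subspace_bound_attained:
  assumes generic: "\<And>e S. e \<in> E \<Longrightarrow> S \<subseteq> E - {e} \<Longrightarrow> x e \<in> span (x ` S) \<Longrightarrow> U e \<subseteq> span (x ` S)"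
    and F: "F \<subseteq> E"
  shows "\<exists>X\<subseteq>F. card (F - X) + dim (\<Union>(U ` X)) \<le> dim (x ` F)"
proof -
  have "finite F" using F finE finite_subset by blast
  then show ?thesis using F
  proof (induction F rule: finite_psubset_induct)
    case (psubset F)
    show ?case
    proof (cases "\<exists>e\<in>F. x e \<notin> span (x ` (F - {e}))")
      case True
      then obtain e where e: "e \<in> F" "x e \<notin> span (x ` (F - {e}))" by auto
      have "F - {e} \<subset> F" using e by auto
      then obtain X where X: "X \<subseteq> F - {e}"
        "card (F - {e} - X) + dim (\<Union>(U ` X)) \<le> dim (x ` (F - {e}))"
        using psubset.IH[of "F - {e}"] psubset.prems by auto
      \<comment> \<open>The removed \<open>e\<close> stays outside \<open>X\<close>, so it adds one
        to the cardinality, which matches the drop of the rank by one.\<close>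
      have "F - X = insert e (F - {e} - X)" using X e by auto
      then have "card (F - X) = Suc (card (F - {e} - X))" using psubset.hyps by simp
      moreover have "x ` F = insert (x e) (x ` (F - {e}))" using e by auto
      then have "dim (x ` F) = Suc (dim (x ` (F - {e})))"
        using dim_insert_notin_span[OF _ e(2)] psubset.hyps by simp
      ultimately show ?thesis using X by (intro exI[of _ X]) auto
    next
      case False
      have "U e \<subseteq> span (x ` F)" if "e \<in> F" for e
      proof -
        have "U e \<subseteq> span (x ` (F - {e}))"
          using that False psubset.prems by (intro generic) auto
        also have "\<dots> \<subseteq> span (x ` F)" by (rule span_mono) auto
        finally show ?thesis .
      qed
      then have "dim (\<Union>(U ` F)) \<le> dim (x ` F)"
        using psubset.hyps by (intro dim_mono_finite) auto
      then show ?thesis by (intro exI[of _ F]) auto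
    qed
  qed
qed

end

text \<open>Identifies the rank of the matroid on indices with a dimension, taking account of
  repeated vectors: two indices with equal vectors are dependent.\<close>

lemma Max_card_independent_subfamily:
  assumes "finite F"
  shows "Max (card ` {I. I \<subseteq> F \<and> inj_on x I \<and> independent (x ` I)}) = dim (x ` F)"
proof (rule Max_eqI)
  show "finite (card ` {I. I \<subseteq> F \<and> inj_on x I \<and> independent (x ` I)})"
    using assms by (auto intro: finite_subset[of _ "Pow F"])
next
  fix n assume "n \<in> card ` {I. I \<subseteq> F \<and> inj_on x I \<and> independent (x ` I)}"
  then obtain I where I: "I \<subseteq> F" "inj_on x I" "independent (x ` I)" "n = card I" by auto
  have "card (x ` I) \<le> dim (x ` F)"
    using I assms dim_mono_finite[of "x ` I" "x ` F"] span_base[of _ "x ` F"]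
    by (auto simp: dim_eq_card_independent)
  then show "n \<le> dim (x ` F)" using I by (simp add: card_image)
next
  obtain B where B: "B \<subseteq> x ` F" "independent B" "card B = dim (x ` F)"
    by (metis basis_exists)
  \<comment> \<open>One index is chosen for every vector of the basis, which makes the subfamily
    injective.\<close>
  obtain I where I: "I \<subseteq> F" "inj_on x I" "x ` I = B"
    using subset_image_inj[THEN iffD1, OF B(1)] by auto
  then have "card I = dim (x ` F)" using B(3) card_image by metis
  with I B show "dim (x ` F) \<in> card ` {I. I \<subseteq> F \<and> inj_on x I \<and> independent (x ` I)}"
    by (metis (mono_tags, lifting) image_eqI mem_Collect_eq)
qed

end

section \<open>Generic vectors\<close>

interpretation fs: vector_space "fun_scale :: 'k::field \<Rightarrow> ('v \<Rightarrow> 'k ^ 'd) \<Rightarrow> 'v \<Rightarrow> 'k ^ 'd"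
  by (rule vector_space_fun_scale)

lemma fun_scale_apply: "fun_scale c x v = c *s x v"
  by (simp add: fun_scale_def)

text \<open>The inclusion of the factor at \<open>v\<close> into the power of \<open>'k ^ 'd\<close>
  indexed by vertices.\<close>

definition at_vertex :: "'v \<Rightarrow> 'k::field ^ 'd \<Rightarrow> 'v \<Rightarrow> 'k ^ 'd" where
  "at_vertex v y = (\<lambda>w. if w = v then y else 0)"

lemma at_vertex_apply: "at_vertex v y w = (if w = v then y else 0)"
  by (simp add: at_vertex_def)

lemma at_vertex_add: "at_vertex v (y + z) = at_vertex v y + at_vertex v z"
  and at_vertex_diff: "at_vertex v (y - z) = at_vertex v y - at_vertex v z"
  and at_vertex_scale: "at_vertex v (c *s y) = fun_scale c (at_vertex v y)"
  and at_vertex_0 [simp]: "at_vertex v 0 = 0"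
  by (auto simp: at_vertex_def fun_eq_iff fun_scale_apply)

text \<open>The standard bilinear form, through which \<open>\<phi>\<close> acts as a linear
  functional. The sum runs over a set \<open>V\<close> because the vertex type may be
  infinite.\<close>

definition pairing :: "'v set \<Rightarrow> ('v \<Rightarrow> 'k::field ^ 'd) \<Rightarrow> ('v \<Rightarrow> 'k ^ 'd) \<Rightarrow> 'k" where
  "pairing V \<phi> x = (\<Sum>v\<in>V. \<Sum>i\<in>UNIV. \<phi> v $ i * x v $ i)"

lemma pairing_linear:
  "pairing V \<phi> (x + y) = pairing V \<phi> x + pairing V \<phi> y"
  "pairing V \<phi> (x - y) = pairing V \<phi> x - pairing V \<phi> y"
  "pairing V (\<phi> - \<xi>) x = pairing V \<phi> x - pairing V \<xi> x"
  "pairing V \<phi> (fun_scale c x) = c * pairing V \<phi> x"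
  "pairing V (fun_scale c \<phi>) x = c * pairing V \<phi> x"
  "pairing V \<phi> 0 = 0"
  by (simp_all add: pairing_def fun_scale_apply ring_distribs sum.distrib sum_subtractf sum_distrib_left mult_ac)

lemma pairing_sum:
  fixes x :: "'i \<Rightarrow> 'v \<Rightarrow> 'k::field ^ 'd"
  shows "pairing V \<phi> (sum x A) = (\<Sum>i\<in>A. pairing V \<phi> (x i))"
  using sum_comp_morphism[of "pairing V \<phi>" x A] by (simp add: pairing_linear)

lemma pairing_span:
  assumes "x \<in> fs.span B" "\<And>b. b \<in> B \<Longrightarrow> pairing V \<phi> b = 0"
  shows "pairing V \<phi> x = 0"
  using assms(1)
proof (induction rule: fs.span_induct)
  case base
  show ?case by (auto simp: fs.subspace_def pairing_linear)
next
  case (step x)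
  then show ?case by (rule assms(2))
qed

definition vectors_over :: "'v set \<Rightarrow> 'k::field set \<Rightarrow> ('v \<Rightarrow> 'k ^ 'd) set" where
  "vectors_over V R = {x. (\<forall>v i. x v $ i \<in> R) \<and> (\<forall>v. v \<notin> V \<longrightarrow> x v = 0)}"

context field_subring
begin

lemma vectors_over_diff:
  "x \<in> vectors_over V R \<Longrightarrow> y \<in> vectors_over V R \<Longrightarrow> x - y \<in> vectors_over V R"
  by (auto simp: vectors_over_def diff)

lemma vectors_over_scale:
  "c \<in> R \<Longrightarrow> x \<in> vectors_over V R \<Longrightarrow> fun_scale c x \<in> vectors_over V R"
  by (auto simp: vectors_over_def fun_scale_apply mult)

lemma pairing_in_subring:
  "x \<in> vectors_over V R \<Longrightarrow> y \<in> vectors_over V R \<Longrightarrow> pairing V x y \<in> R"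
  unfolding pairing_def by (intro sum mult) (auto simp: vectors_over_def)

text \<open>Fraction-free Gaussian elimination: separating functionals can be taken over the subring.\<close>

lemma separating_functional:
  fixes u :: "'v \<Rightarrow> 'k ^ 'd"
  assumes "finite V" "finite B" "B \<subseteq> vectors_over V R" "u \<in> vectors_over V R" "u \<notin> fs.span B"
  shows "\<exists>\<phi>\<in>vectors_over V R. (\<forall>b\<in>B. pairing V \<phi> b = 0) \<and> pairing V \<phi> u \<noteq> 0"
  using assms(2-)
proof (induction B arbitrary: u rule: finite_induct)
  case empty
  then have "u \<noteq> 0" by auto
  then obtain v where v: "u v \<noteq> 0" by (auto simp: fun_eq_iff)
  then obtain i where i: "u v $ i \<noteq> 0" by (auto simp: vec_eq_iff)
  have "v \<in> V" using v empty by (auto simp: vectors_over_def)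
  \<comment> \<open>With no vectors to annihilate, reading off one nonzero coordinate of
    \<open>u\<close> is enough.\<close>
  have "pairing V (at_vertex v (axis i 1)) u = (\<Sum>w\<in>V. if w = v then u v $ i else 0)"
    unfolding pairing_def at_vertex_def axis_def
    by (intro sum.cong refl) (auto simp: if_distrib[of "\<lambda>x. x * _"] cong: if_cong)
  also have "\<dots> \<noteq> 0" using i \<open>v \<in> V\<close> assms(1) by simp
  finally have "pairing V (at_vertex v (axis i 1)) u \<noteq> 0" .
  moreover have "at_vertex v (axis i 1) \<in> vectors_over V R"
    using \<open>v \<in> V\<close> one zero by (auto simp: vectors_over_def at_vertex_def axis_def)
  ultimately show ?case by auto
next
  case (insert b B)
  have b: "b \<in> vectors_over V R" and B: "B \<subseteq> vectors_over V R" using insert.prems by auto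
  show ?case
  proof (cases "b \<in> fs.span B")
    case True
    have "u \<notin> fs.span B" using insert.prems(3) fs.span_mono[of B "insert b B"] by blast
    from insert.IH[OF B insert.prems(2) this] obtain \<phi> where
      \<phi>: "\<phi> \<in> vectors_over V R" "\<forall>b\<in>B. pairing V \<phi> b = 0" "pairing V \<phi> u \<noteq> 0" by auto
    then have "pairing V \<phi> b = 0" using pairing_span[OF True] by auto
    with \<phi> show ?thesis by auto
  next
    case False
    from insert.IH[OF B b this] obtain \<phi> where
      \<phi>: "\<phi> \<in> vectors_over V R" "\<forall>b\<in>B. pairing V \<phi> b = 0" "pairing V \<phi> b \<noteq> 0" by auto
    define c where "c = pairing V \<phi> b"
    have c: "c \<in> R" "c \<noteq> 0" using pairing_in_subring[OF \<phi>(1) b] \<phi>(3) by (auto simp: c_def)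
    \<comment> \<open>This is \<open>u\<close> reduced modulo \<open>b\<close> so that
      \<open>\<phi>\<close> annihilates it, multiplied by \<open>c\<close> in place of dividing by
      \<open>c\<close>; its coordinates therefore stay in \<open>R\<close>.\<close>
    define u' where "u' = fun_scale c u - fun_scale (pairing V \<phi> u) b"
    have u': "u' \<in> vectors_over V R"
      unfolding u'_def using insert.prems(2) b \<phi>(1) c
      by (intro vectors_over_diff vectors_over_scale pairing_in_subring)
    have "u' \<notin> fs.span B"
    proof
      assume "u' \<in> fs.span B"
      then have "u' \<in> fs.span (insert b B)" using fs.span_mono[of B "insert b B"] by blast
      moreover have "fun_scale (pairing V \<phi> u) b \<in> fs.span (insert b B)"
        by (intro fs.span_scale fs.span_base) auto
      ultimately have "u' + fun_scale (pairing V \<phi> u) b \<in> fs.span (insert b B)"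
        by (rule fs.span_add)
      then have "fun_scale c u \<in> fs.span (insert b B)" by (simp add: u'_def)
      \<comment> \<open>Here \<open>c\<close> is inverted in the field; the functional itself is
        built without division.\<close>
      then have "fun_scale (inverse c) (fun_scale c u) \<in> fs.span (insert b B)"
        by (rule fs.span_scale)
      then show False using insert.prems(3) c(2) by (simp only: fs.scale_scale left_inverse fs.scale_one not_False_eq_True)
    qed
    from insert.IH[OF B u' this] obtain \<psi> where
      \<psi>: "\<psi> \<in> vectors_over V R" "\<forall>b\<in>B. pairing V \<psi> b = 0" "pairing V \<psi> u' \<noteq> 0" by auto
    \<comment> \<open>The multiple of \<open>\<phi>\<close> is chosen so that \<open>\<xi>\<close>
      annihilates \<open>b\<close>. The same cross-multiplication gives \<open>\<xi>\<close> at
      \<open>u\<close> the value of \<open>\<psi>\<close> at \<open>u'\<close>.\<close>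
    define \<xi> where "\<xi> = fun_scale c \<psi> - fun_scale (pairing V \<psi> b) \<phi>"
    have "\<xi> \<in> vectors_over V R"
      unfolding \<xi>_def using b \<phi>(1) \<psi>(1) c
      by (intro vectors_over_diff vectors_over_scale pairing_in_subring)
    moreover have "pairing V \<xi> b' = 0" if "b' \<in> insert b B" for b'
      using that \<phi>(2) \<psi>(2) by (auto simp: \<xi>_def pairing_linear c_def)
    moreover have "pairing V \<xi> u = pairing V \<psi> u'"
      by (simp add: \<xi>_def u'_def pairing_linear)
    ultimately show ?thesis using \<psi>(3) by metis
  qed
qed

end

text \<open>If some \<open>u i\<close> were outside the span, a functional over \<open>R\<close>
  would annihilate \<open>B\<close> but not \<open>u i\<close>. Applied to the combination, it gives
  a linear relation between the coordinates of \<open>\<alpha> e\<close> with coefficients in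
  \<open>R\<close>. As \<open>R\<close> does not involve these coordinates, all coefficients vanish,
  a contradiction.\<close>

lemma generic_combination_in_span:
  fixes \<iota> :: "'f::field \<Rightarrow> 'k::field" and \<alpha> :: "'e \<Rightarrow> 'k ^ 'd" and B :: "('v \<Rightarrow> 'k ^ 'd) set"
  assumes ext: "field_extension \<iota>"
    and indep: "algebraically_independent \<iota> (E \<times> UNIV) (\<lambda>(e, i). \<alpha> e $ i)"
    and e: "e \<in> E" and fin: "finite V" "finite B"
    and R: "R = poly_values \<iota> ((E - {e}) \<times> UNIV) (\<lambda>(e, i). \<alpha> e $ i)"
    and B: "B \<subseteq> vectors_over V R" and u: "\<And>i. u i \<in> vectors_over V R"
    and span: "(\<Sum>i\<in>UNIV. fun_scale (\<alpha> e $ i) (u i)) \<in> fs.span B"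
  shows "u i \<in> fs.span B"
proof (rule ccontr)
  assume "u i \<notin> fs.span B"
  interpret field_subring R unfolding R by (rule field_subring_poly_values[OF ext])
  obtain \<phi> where \<phi>: "\<phi> \<in> vectors_over V R" "\<forall>b\<in>B. pairing V \<phi> b = 0" "pairing V \<phi> (u i) \<noteq> 0"
    using separating_functional[OF fin B u \<open>u i \<notin> fs.span B\<close>] by auto
  have "(\<Sum>i\<in>UNIV. \<alpha> e $ i * pairing V \<phi> (u i)) = 0"
    using pairing_span[OF span] \<phi>(2) by (simp add: pairing_sum pairing_linear)
  then have "pairing V \<phi> (u i) = 0"
    using pairing_in_subring[OF \<phi>(1) u] e
    by (intro algebraically_independent_linear[OF ext indep,
          where D = UNIV and z = "Pair e" and J = "(E - {e}) \<times> UNIV" and r = "\<lambda>i. pairing V \<phi> (u i)"])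
      (auto simp: R inj_on_def)
  with \<phi>(3) show False by simp
qed

section \<open>Products of subspaces and extension of scalars\<close>

lemma (in vector_space_pair) dim_injective_image:
  assumes "Vector_Spaces.linear s1 s2 f" "inj f"
  shows "vs2.dim (f ` V) = vs1.dim V"
proof -
  obtain B where B: "B \<subseteq> V" "vs1.independent B" "V \<subseteq> vs1.span B" "card B = vs1.dim V"
    using vs1.basis_exists[of V] by auto
  have "vs2.independent (f ` B)"
    using linear_independent_injective_image[OF assms(1) B(2)] assms(2) by (auto intro: inj_on_subset)
  moreover have "f ` V \<subseteq> vs2.span (f ` B)"
    using B(3) linear_span_image[OF assms(1)] by (metis image_mono)
  moreover have "card (f ` B) = card B"
    using assms(2) by (intro card_image) (auto intro: inj_on_subset)
  ultimately show ?thesis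
    using B by (intro vs2.dim_unique[of "f ` B"]) auto
qed

lemma at_vertex_eq_iff: "at_vertex v y = at_vertex w z \<longleftrightarrow> y = z \<and> (v = w \<or> y = 0)"
proof
  assume eq: "at_vertex v y = at_vertex w z"
  show "y = z \<and> (v = w \<or> y = 0)"
    using fun_cong[OF eq, of v] fun_cong[OF eq, of w]
    by (simp add: at_vertex_apply split: if_splits)
qed auto

text \<open>Bases of the single factors unite to a basis of the product; evaluation at
  \<open>v\<close> reduces independence to that of the basis chosen for the factor at
  \<open>v\<close>.\<close>

lemma dim_at_vertex_Union:
  fixes D :: "'v \<Rightarrow> ('k::field ^ 'd) set"
  assumes "finite V"
  shows "fs.dim (\<Union>v\<in>V. at_vertex v ` D v) = (\<Sum>v\<in>V. vec.dim (D v))"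
proof -
  have "\<exists>B. B \<subseteq> D v \<and> vec.independent B \<and> D v \<subseteq> vec.span B \<and> card B = vec.dim (D v)" for v
    using vec.basis_exists[of "D v"] by metis
  then obtain B where B: "\<And>v. B v \<subseteq> D v" "\<And>v. vec.independent (B v)"
    "\<And>v. D v \<subseteq> vec.span (B v)" "\<And>v. card (B v) = vec.dim (D v)"
    by metis
  \<comment> \<open>Only the zero vector has the same image under the inclusions of two different
    vertices, so this makes the bases disjoint.\<close>
  have nz: "b \<noteq> 0" if "b \<in> B v" for b v using B(2) that vec.dependent_zero by blast
  let ?B = "\<Union>v\<in>V. at_vertex v ` B v"
  have "fs.independent ?B"
    unfolding fs.dependent_def
  proof safe
    fix v b assume v: "v \<in> V" and b: "b \<in> B v"
      and span: "at_vertex v b \<in> fs.span (?B - {at_vertex v b})"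
    from span have "at_vertex v b v \<in> vec.span (B v - {b})"
    proof (induction rule: fs.span_induct)
      case base
      show ?case by (auto simp: fs.subspace_def fun_scale_apply vec.span_zero vec.span_add vec.span_scale)
    next
      case (step x)
      then obtain w c where c: "c \<in> B w" "x = at_vertex w c" "x \<noteq> at_vertex v b" by auto
      show ?case
      proof (cases "w = v")
        case True
        then show ?thesis using c by (auto simp: at_vertex_apply intro: vec.span_base)
      qed (simp add: c at_vertex_apply vec.span_zero)
    qed
    then show False
      using B(2)[of v] b by (auto simp: at_vertex_apply vec.dependent_def)
  qed
  moreover have "at_vertex v y \<in> fs.span ?B" if "v \<in> V" "y \<in> D v" for v y
  proof -
    have "y \<in> vec.span (B v)" using B(3) that(2) by blast
    then show ?thesis
    proof (induction rule: vec.span_induct)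
      case base
      show ?case
        by (auto simp: vec.subspace_def at_vertex_add at_vertex_scale fs.span_zero fs.span_add fs.span_scale)
    next
      case (step y)
      then show ?case using that(1) by (intro fs.span_base) auto
    qed
  qed
  moreover have "card ?B = (\<Sum>v\<in>V. card (at_vertex v ` B v))"
  proof (rule card_UN_disjoint[OF assms])
    show "\<forall>v\<in>V. finite (at_vertex v ` B v)"
      using B(2) vec.finiteI_independent by blast
    show "\<forall>v\<in>V. \<forall>w\<in>V. v \<noteq> w \<longrightarrow> at_vertex v ` B v \<inter> at_vertex w ` B w = {}"
      using nz by (auto simp: at_vertex_eq_iff)
  qed
  moreover have "card (at_vertex v ` B v) = vec.dim (D v)" for v
    unfolding B(4)[symmetric]
    by (intro card_image inj_onI) (simp add: at_vertex_eq_iff)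
  moreover have "?B \<subseteq> (\<Union>v\<in>V. at_vertex v ` D v)" using B(1) by blast
  ultimately show ?thesis by (intro fs.dim_unique[of ?B]) auto
qed

section \<open>Extension of scalars\<close>

definition map_vec :: "('a \<Rightarrow> 'b) \<Rightarrow> 'a ^ 'n \<Rightarrow> 'b ^ 'n" where
  "map_vec f x = (\<chi> i. f (x $ i))"

lemma map_vec_nth [simp]: "map_vec f x $ i = f (x $ i)"
  by (simp add: map_vec_def)

context
  fixes \<iota> :: "'f::field \<Rightarrow> 'k::field"
  assumes ext: "field_extension \<iota>"
begin

lemmas ext_simps = field_extension_simps[OF ext] field_extension_sum[OF ext]

lemma map_matrix_mult: "map_matrix \<iota> (A ** B) = map_matrix \<iota> A ** map_matrix \<iota> B"
  by (simp add: vec_eq_iff matrix_matrix_mult_def ext_simps)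

lemma map_matrix_mat_1: "map_matrix \<iota> (mat 1) = mat 1"
  by (simp add: vec_eq_iff mat_def ext_simps)

lemma map_matrix_diff: "map_matrix \<iota> (A - B) = map_matrix \<iota> A - map_matrix \<iota> B"
  by (simp add: vec_eq_iff ext_simps)

lemma map_matrix_vector_mult: "map_matrix \<iota> A *v map_vec \<iota> x = map_vec \<iota> (A *v x)"
  by (simp add: vec_eq_iff matrix_vector_mult_def ext_simps)

lemma map_vec_axis: "map_vec \<iota> (axis i 1) = axis i 1"
  by (simp add: vec_eq_iff axis_def ext_simps)

lemma inj_map_vec: "inj (map_vec \<iota>)"
proof (rule injI)
  fix x y :: "'f ^ 'd" assume eq: "map_vec \<iota> x = map_vec \<iota> y"
  have "x $ i - y $ i = 0" for i
  proof (rule ccontr)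
    assume nz: "x $ i - y $ i \<noteq> 0"
    have "\<iota> (x $ i - y $ i) = 0" using eq by (simp add: ext_simps vec_eq_iff)
    then have "\<iota> (inverse (x $ i - y $ i) * (x $ i - y $ i)) = 0" by (simp add: ext_simps)
    with nz show False by (simp add: ext_simps)
  qed
  then show "x = y" by (simp add: vec_eq_iff)
qed

text \<open>Independence survives the extension because it is witnessed by matrices over the base
  field: for \<open>b\<close> in the basis, one matrix annihilates the other basis vectors but not
  \<open>b\<close>, and its image under \<open>\<iota>\<close> does the same over the larger
  field.\<close>

lemma dim_map_vec_image:
  fixes S :: "('f ^ 'd) set"
  shows "vec.dim (map_vec \<iota> ` S) = vec.dim S"
proof -
  obtain B where B: "B \<subseteq> S" "vec.independent B" "S \<subseteq> vec.span B" "card B = vec.dim S"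
    using vec.basis_exists[of S] by metis
  have "map_vec \<iota> y \<in> vec.span (map_vec \<iota> ` B)" if "y \<in> S" for y
  proof -
    have "y \<in> vec.span B" using that B(3) by auto
    then show ?thesis
    proof (induction rule: vec.span_induct)
      case base
      have "map_vec \<iota> (0 :: 'f ^ 'd) = 0" "map_vec \<iota> (x + y) = map_vec \<iota> x + map_vec \<iota> y"
        "map_vec \<iota> (c *s x) = \<iota> c *s map_vec \<iota> x" for c and x y :: "'f ^ 'd"
        by (auto simp: vec_eq_iff ext_simps)
      then show ?case
        by (auto simp: vec.subspace_def intro: vec.span_zero vec.span_add vec.span_scale)
    qed (auto intro: vec.span_base)
  qed
  moreover have "vec.independent (map_vec \<iota> ` B)"
    unfolding vec.dependent_def
  proof safe
    fix b assume b: "b \<in> B"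
      and span: "map_vec \<iota> b \<in> vec.span (map_vec \<iota> ` B - {map_vec \<iota> b})"
    \<comment> \<open>Any coordinate will do, since all that matters is a nonzero target vector with
      entries 0 and 1.\<close>
    define i0 :: 'd where "i0 = undefined"
    obtain f where f: "Vector_Spaces.linear (*s) (*s) f"
      "\<forall>x\<in>B. f x = (if x = b then axis i0 1 else 0 :: 'f ^ 'd)"
      using vec.linear_independent_extend[OF B(2), of "\<lambda>x. if x = b then axis i0 1 else 0"] by auto
    have "f x = matrix f *v x" for x using matrix_works[OF f(1)] by simp
    then have M: "map_matrix \<iota> (matrix f) *v map_vec \<iota> x = map_vec \<iota> (f x)" for x
      by (simp add: map_matrix_vector_mult)
    have "map_matrix \<iota> (matrix f) *v map_vec \<iota> b = 0"
      using span
    proof (induction rule: vec.span_induct)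
      case base
      show ?case
        by (auto simp: vec.subspace_def matrix_vector_right_distrib vec.scale)
    next
      case (step z)
      then show ?case using f(2) by (auto simp: M vec_eq_iff ext_simps)
    qed
    then show False using f(2) b by (simp add: M map_vec_axis)
  qed
  moreover have "card (map_vec \<iota> ` B) = card B"
    by (intro card_image inj_on_subset[OF inj_map_vec]) auto
  ultimately show ?thesis
    using B by (intro vec.dim_unique[of "map_vec \<iota> ` B"]) auto
qed

text \<open>The image of a matrix is spanned by its columns, and here these come from the base
  field. Hence both sides are dimensions attached to the same columns, before and after extending
  scalars.\<close>

lemma rep_dim_extension:
  "vec.dim (\<Union>\<gamma>\<in>X. range (\<lambda>y. (mat 1 - map_matrix \<iota> (\<rho> \<gamma>)) *v y)) = rep_dim \<rho> X"
proof -
  let ?K = "\<Union>\<gamma>\<in>X. range (\<lambda>y. (mat 1 - map_matrix \<iota> (\<rho> \<gamma>)) *v y)"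
  let ?F = "\<Union>\<gamma>\<in>X. range (\<lambda>y. (mat 1 - \<rho> \<gamma>) *v y)"
  have I: "mat 1 - map_matrix \<iota> (\<rho> \<gamma>) = map_matrix \<iota> (mat 1 - \<rho> \<gamma>)" for \<gamma>
    by (simp add: map_matrix_diff map_matrix_mat_1)
  have "(mat 1 - map_matrix \<iota> (\<rho> \<gamma>)) *v y \<in> vec.span (map_vec \<iota> ` ?F)" if "\<gamma> \<in> X" for \<gamma> y
  proof -
    have "(mat 1 - map_matrix \<iota> (\<rho> \<gamma>)) *v y =
        (\<Sum>i\<in>UNIV. y $ i *s ((mat 1 - map_matrix \<iota> (\<rho> \<gamma>)) *v axis i 1))"
      by (subst basis_expansion[symmetric, of y]) (simp only: vec.sum vec.scale)
    also have "\<dots> = (\<Sum>i\<in>UNIV. y $ i *s (map_vec \<iota> ((mat 1 - \<rho> \<gamma>) *v axis i 1)))"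
      unfolding I by (metis map_matrix_vector_mult map_vec_axis)
    also have "\<dots> \<in> vec.span (map_vec \<iota> ` ?F)"
      using that by (intro vec.span_sum vec.span_scale vec.span_base) auto
    finally show ?thesis .
  qed
  then have "?K \<subseteq> vec.span (map_vec \<iota> ` ?F)" by auto
  moreover have "map_vec \<iota> ` ?F \<subseteq> ?K"
    unfolding I by (auto simp: map_matrix_vector_mult[symmetric])
  then have "map_vec \<iota> ` ?F \<subseteq> vec.span ?K" using vec.span_superset by blast
  ultimately have "vec.span ?K = vec.span (map_vec \<iota> ` ?F)"
    by (simp add: vec.span_eq)
  then have "vec.dim ?K = vec.dim (map_vec \<iota> ` ?F)" by (rule vec.span_eq_dim)
  then show ?thesis by (simp add: dim_map_vec_image rep_dim_def)
qed

end

section \<open>The dimension of the edge subspaces\<close>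

lemma is_walk_mono: "is_walk G X u p w \<Longrightarrow> X \<subseteq> Y \<Longrightarrow> is_walk G Y u p w"
  by (induction p arbitrary: u) auto

lemma is_walk_end_verts:
  "is_walk G X u p w \<Longrightarrow> u \<in> end_verts G X \<Longrightarrow> w \<in> end_verts G X"
proof (induction p arbitrary: u)
  case (Cons s p)
  obtain e b where "s = (e, b)" by (cases s)
  with Cons.prems have "step_dst G s \<in> end_verts G X" by (auto simp: end_verts_def)
  with Cons show ?case by auto
qed auto

text \<open>For \<open>t = h\<close> the two terms combine to \<open>y - A *v y\<close> at one
  vertex, so loops need no separate case. The formula also serves for whole walks from
  \<open>t\<close> to \<open>h\<close> with gain matrix \<open>A\<close>.\<close>

definition edge_map :: "'k::field ^ 'd ^ 'd \<Rightarrow> 'v \<Rightarrow> 'v \<Rightarrow> 'k ^ 'd \<Rightarrow> 'v \<Rightarrow> 'k ^ 'd" where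
  "edge_map A t h y = at_vertex h y - at_vertex t (A *v y)"

locale gain_representation = group \<Gamma> for \<Gamma> :: "('g, 'm) monoid_scheme" (structure) +
  fixes \<rho> :: "'g \<Rightarrow> 'f::field ^ 'd ^ 'd"
    and G :: "('v, 'e) pre_digraph"
    and \<psi> :: "'e \<Rightarrow> 'g"
    and \<iota> :: "'f \<Rightarrow> 'k::field"
  assumes rho: "\<rho> \<in> hom \<Gamma> GL"
    and fin: "fin_digraph G"
    and psi: "\<psi> \<in> arcs G \<rightarrow> carrier \<Gamma>"
    and ext: "field_extension \<iota>"
begin

definition \<sigma> :: "'g \<Rightarrow> 'k ^ 'd ^ 'd" where
  "\<sigma> \<gamma> = map_matrix \<iota> (\<rho> \<gamma>)"

text \<open>The range of \<open>edge_gen e\<close> is the subspace in which the vector of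
  \<open>e\<close> is generic; that vector is the value at \<open>\<alpha> e\<close>.\<close>

definition edge_gen :: "'e \<Rightarrow> 'k ^ 'd \<Rightarrow> 'v \<Rightarrow> 'k ^ 'd" where
  "edge_gen e = edge_map (\<sigma> (\<psi> e)) (tail G e) (head G e)"

definition edge_space :: "'e set \<Rightarrow> ('v \<Rightarrow> 'k ^ 'd) set" where
  "edge_space X = fs.span (\<Union>e\<in>X. range (edge_gen e))"

lemma sigma_mult:
  assumes "a \<in> carrier \<Gamma>" "b \<in> carrier \<Gamma>"
  shows "\<sigma> (a \<otimes> b) = \<sigma> a ** \<sigma> b"
  using hom_mult[OF rho assms] by (simp add: GL_def \<sigma>_def map_matrix_mult[OF ext])

text \<open>\<open>\<rho> \<one>\<close> is idempotent and invertible, hence the identity.\<close>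

lemma sigma_one: "\<sigma> \<one> = mat 1"
proof -
  have "invertible (\<rho> \<one>)"
    using hom_in_carrier[OF rho one_closed] by (simp add: GL_def)
  then obtain B where B: "\<rho> \<one> ** B = mat 1" by (auto simp: invertible_def)
  have "\<rho> \<one> ** \<rho> \<one> = \<rho> \<one>"
    using hom_mult[OF rho one_closed one_closed] by (simp add: GL_def)
  then have "\<rho> \<one> ** (\<rho> \<one> ** B) = \<rho> \<one> ** B" by (metis matrix_mul_assoc)
  then have "\<rho> \<one> = mat 1" by (simp add: B)
  then show ?thesis by (simp add: \<sigma>_def map_matrix_mat_1[OF ext])
qed

lemma edge_gen_add: "edge_gen e (y + z) = edge_gen e y + edge_gen e z"
  and edge_gen_scale: "edge_gen e (c *s y) = fun_scale c (edge_gen e y)"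
  and edge_gen_0: "edge_gen e 0 = 0"
  by (simp_all add: edge_gen_def edge_map_def at_vertex_add matrix_vector_right_distrib
      at_vertex_scale vec.scale fs.scale_right_diff_distrib)

lemma edge_gen_expansion:
  "edge_gen e y = (\<Sum>i\<in>UNIV. fun_scale (y $ i) (edge_gen e (axis i 1)))"
proof -
  have "edge_gen e (\<Sum>i\<in>A. y $ i *s axis i 1) =
      (\<Sum>i\<in>A. fun_scale (y $ i) (edge_gen e (axis i 1)))" for A
    using sum_comp_morphism[of "edge_gen e" "\<lambda>i. y $ i *s axis i 1" A]
    by (simp only: edge_gen_0 edge_gen_add edge_gen_scale comp_def)
  from this[of UNIV] show ?thesis by (simp only: basis_expansion)
qed

lemma edge_vec_eq_edge_gen: "edge_vec \<iota> \<rho> G \<psi> \<alpha> e = edge_gen e (\<alpha> e)"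
  by (auto simp: fun_eq_iff edge_vec_def Let_def edge_gen_def edge_map_def at_vertex_def \<sigma>_def
      matrix_vector_mult_diff_rdistrib)

context
  fixes X :: "'e set"
  assumes X: "X \<subseteq> arcs G"
begin

lemma psi_X: "\<psi> \<in> X \<rightarrow> carrier \<Gamma>"
  using psi X by auto

lemmas walk_gain_carrier = walk_gain_closed[OF group_axioms psi_X]

lemma finite_X: "finite X"
proof -
  interpret fin_digraph G by (rule fin)
  show ?thesis using X finite_arcs by (rule finite_subset)
qed

lemma finite_end_verts: "finite (end_verts G X)"
  using finite_X by (simp add: end_verts_def)

text \<open>The vectors of the steps telescope: with suitable arguments, the contributions at inner
  vertices of the walk cancel.\<close>

lemma walk_in_edge_space:
  "is_walk G X u p w \<Longrightarrow> edge_map (\<sigma> (walk_gain \<Gamma> \<psi> p)) u w y \<in> edge_space X"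
proof (induction p arbitrary: u)
  case Nil
  then have "edge_map (\<sigma> (walk_gain \<Gamma> \<psi> [])) u w y = 0"
    by (simp add: edge_map_def sigma_one fun_eq_iff)
  then show ?case unfolding edge_space_def by (simp only: fs.span_zero)
next
  case (Cons s p)
  obtain e b where s: "s = (e, b)" by (cases s)
  have e: "e \<in> X" and p: "is_walk G X (step_dst G s) p w" and u: "step_src G s = u"
    using Cons.prems s by auto
  have c: "step_gain \<Gamma> \<psi> s \<in> carrier \<Gamma>" "walk_gain \<Gamma> \<psi> p \<in> carrier \<Gamma>"
    using step_gain_closed[OF group_axioms psi_X, of s] walk_gain_carrier[OF p] e s by auto
  \<comment> \<open>\<open>y\<close> transported back along \<open>p\<close> to the vertex after the
    first step, where it has to cancel the contribution of the rest of the walk.\<close>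
  define z where "z = \<sigma> (walk_gain \<Gamma> \<psi> p) *v y"
  have gen: "edge_gen e x \<in> edge_space X" for x
    unfolding edge_space_def using e by (intro fs.span_base) auto
  have "edge_map (\<sigma> (step_gain \<Gamma> \<psi> s)) u (step_dst G s) z \<in> edge_space X"
  proof (cases b)
    case True
    then have "edge_map (\<sigma> (step_gain \<Gamma> \<psi> s)) u (step_dst G s) z = edge_gen e z"
      using u s by (simp add: edge_gen_def)
    then show ?thesis using gen by simp
  next
    case False
    have pe: "\<psi> e \<in> carrier \<Gamma>" using psi_X e by auto
    \<comment> \<open>Traversing \<open>e\<close> backwards gives the negative of its vector, with
      the argument corrected by the inverse gain.\<close>
    have "\<sigma> (\<psi> e) *v (\<sigma> (inv (\<psi> e)) *v z) = z"
      using pe by (simp add: matrix_vector_mul_assoc sigma_mult[symmetric] sigma_one)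
    then have "edge_map (\<sigma> (step_gain \<Gamma> \<psi> s)) u (step_dst G s) z =
        - edge_gen e (\<sigma> (inv (\<psi> e)) *v z)"
      using u s False by (simp add: edge_gen_def edge_map_def)
    then show ?thesis using gen fs.span_neg unfolding edge_space_def by metis
  qed
  moreover have "edge_map (\<sigma> (walk_gain \<Gamma> \<psi> (s # p))) u w y =
      edge_map (\<sigma> (walk_gain \<Gamma> \<psi> p)) (step_dst G s) w y +
      edge_map (\<sigma> (step_gain \<Gamma> \<psi> s)) u (step_dst G s) z"
    using c by (simp add: edge_map_def z_def sigma_mult matrix_vector_mul_assoc del: step_gain.simps)
  ultimately show ?case
    using Cons.IH[OF p] unfolding edge_space_def by (simp only: fs.span_add)
qed

section \<open>Roots of components and gains of paths from them\<close>

definition root :: "'v \<Rightarrow> 'v" where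
  "root v = (SOME w. \<exists>p. is_walk G X v p w)"

lemma walk_to_root: "\<exists>p. is_walk G X v p (root v)"
proof -
  have "\<exists>w p. is_walk G X v p w" by (intro exI[of _ v] exI[of _ "[]"]) simp
  then show ?thesis unfolding root_def by (rule someI_ex)
qed

text \<open>Walks can be reversed, so \<open>u\<close> and \<open>w\<close> reach the same vertices,
  and \<open>root\<close> is a choice that depends only on the set of reachable vertices.\<close>

lemma root_eqI:
  assumes "is_walk G X u p w"
  shows "root u = root w"
proof -
  have "(\<exists>q. is_walk G X u q x) \<longleftrightarrow> (\<exists>q. is_walk G X w q x)" for x
    using assms is_walk_rev[OF assms] by (meson is_walk_append)
  then show ?thesis by (simp add: root_def)
qed

lemma root_root [simp]: "root (root v) = root v"
  using walk_to_root root_eqI by metis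

lemma root_eq_iff_walk: "root u = root w \<longleftrightarrow> (\<exists>p. is_walk G X u p w)"
  using walk_to_root[of u] walk_to_root[of w] root_eqI is_walk_rev is_walk_append by metis

lemma root_in_end_verts: "v \<in> end_verts G X \<Longrightarrow> root v \<in> end_verts G X"
  using walk_to_root is_walk_end_verts by metis

lemma root_head: "e \<in> X \<Longrightarrow> root (head G e) = root (tail G e)"
  unfolding root_eq_iff_walk by (intro exI[of _ "[(e, False)]"]) simp

text \<open>The empty path is forced at a root; another closed walk there could have nontrivial
  gain, while \<open>switch\<close> relies on the gain \<open>\<one>\<close> at roots.\<close>

definition path :: "'v \<Rightarrow> ('e \<times> bool) list" where
  "path v = (SOME p. is_walk G X (root v) p v \<and> (root v = v \<longrightarrow> p = []))"

lemma path: "is_walk G X (root v) (path v) v" "root v = v \<Longrightarrow> path v = []"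
proof -
  have "\<exists>p. is_walk G X (root v) p v \<and> (root v = v \<longrightarrow> p = [])"
    by (cases "root v = v") (auto simp flip: root_eq_iff_walk)
  then have "is_walk G X (root v) (path v) v \<and> (root v = v \<longrightarrow> path v = [])"
    unfolding path_def by (rule someI_ex)
  then show "is_walk G X (root v) (path v) v" "root v = v \<Longrightarrow> path v = []" by auto
qed

definition gain_to :: "'v \<Rightarrow> 'g" where
  "gain_to v = walk_gain \<Gamma> \<psi> (path v)"

lemma gain_to_carrier: "gain_to v \<in> carrier \<Gamma>"
  unfolding gain_to_def by (rule walk_gain_carrier[OF path(1)])

lemma gain_to_root: "root v = v \<Longrightarrow> gain_to v = \<one>"
  by (simp add: gain_to_def path(2))

text \<open>Generators of the factors into which \<open>switch\<close> decomposes the edge subspace: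
  a root carries the span measured by \<open>rep_dim\<close>, any other vertex the full
  space.\<close>

definition local_gens :: "'v \<Rightarrow> ('k ^ 'd) set" where
  "local_gens v = (if root v = v
     then \<Union>\<gamma>\<in>gain_group \<Gamma> G \<psi> X v. range (\<lambda>y. (mat 1 - \<sigma> \<gamma>) *v y) else UNIV)"

text \<open>
  Switching at every vertex \<open>v\<close> by the gain of a path from the root of its component, followed
  by a transfer of the value to the root, turns the edge subspace into a product over the vertices.
\<close>

definition switch :: "('v \<Rightarrow> 'k ^ 'd) \<Rightarrow> 'v \<Rightarrow> 'k ^ 'd" where
  "switch x w = (if w \<in> root ` end_verts G X
     then \<Sum>v | v \<in> end_verts G X \<and> root v = w. \<sigma> (gain_to v) *v x v else x w)"

lemma linear_switch: "Vector_Spaces.linear fun_scale fun_scale switch"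
proof -
  have "switch (x + y) = switch x + switch y" for x y
    by (auto simp: fun_eq_iff switch_def matrix_vector_right_distrib sum.distrib)
  moreover have "switch (fun_scale c x) = fun_scale c (switch x)" for c x
    by (auto simp: fun_eq_iff switch_def fun_scale_apply vec.scale vec.scale_sum_right)
  ultimately show ?thesis
    using vector_space_fun_scale unfolding Vector_Spaces.linear_iff by blast
qed

interpretation switch: Vector_Spaces.linear fun_scale fun_scale switch
  by (rule linear_switch)

lemma switch_at_vertex:
  assumes "v \<in> end_verts G X"
  shows "switch (at_vertex v y) =
    at_vertex (root v) (\<sigma> (gain_to v) *v y) + (if root v = v then 0 else at_vertex v y)"
proof
  fix w
  show "switch (at_vertex v y) w =
    (at_vertex (root v) (\<sigma> (gain_to v) *v y) + (if root v = v then 0 else at_vertex v y)) w"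
  proof (cases "w \<in> root ` end_verts G X")
    case True
    then have w: "root w = w" by auto
    have "switch (at_vertex v y) w =
        (\<Sum>u | u \<in> end_verts G X \<and> root u = w. if u = v then \<sigma> (gain_to v) *v y else 0)"
      using True by (auto simp: switch_def at_vertex_apply intro!: sum.cong)
    also have "\<dots> = (if root v = w then \<sigma> (gain_to v) *v y else 0)"
      using assms finite_end_verts by (simp add: sum.delta)
    finally show ?thesis using w by (auto simp: at_vertex_apply)
  next
    case False
    then show ?thesis using assms by (auto simp: switch_def at_vertex_apply)
  qed
qed

text \<open>\<open>switch\<close> keeps the values at all vertices outside the set of roots, so a
  kernel vector vanishes there. In the sum at a root, only the term of the root itself remains, and
  its gain is trivial.\<close>

lemma inj_switch: "inj switch"
proof -
  have "x = 0" if "switch x = 0" for x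
  proof -
    have nonroot: "x v = 0" if "v \<notin> root ` end_verts G X" for v
      using fun_cong[OF \<open>switch x = 0\<close>, of v] that by (simp add: switch_def)
    have "x r = 0" if r: "r \<in> root ` end_verts G X" for r
    proof -
      have rr: "root r = r" "r \<in> end_verts G X" using r root_in_end_verts by auto
      have "(\<Sum>v | v \<in> end_verts G X \<and> root v = r. \<sigma> (gain_to v) *v x v) =
          (\<Sum>v | v \<in> end_verts G X \<and> root v = r. if v = r then x r else 0)"
      proof (intro sum.cong refl)
        fix v assume v: "v \<in> {v \<in> end_verts G X. root v = r}"
        show "\<sigma> (gain_to v) *v x v = (if v = r then x r else 0)"
        proof (cases "v = r")
          case False
          then have "v \<notin> root ` end_verts G X" using v by auto
          then show ?thesis using False by (simp add: nonroot)
        qed (simp add: gain_to_root sigma_one rr)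
      qed
      also have "\<dots> = x r" using rr finite_end_verts by (simp add: sum.delta)
      finally show ?thesis
        using fun_cong[OF \<open>switch x = 0\<close>, of r] r by (simp add: switch_def)
    qed
    with nonroot show ?thesis by (auto simp: fun_eq_iff)
  qed
  then show ?thesis using switch.inj_iff_eq_0 by blast
qed

text \<open>Vertices other than the root impose no condition. At the root the two ends of
  \<open>e\<close> contribute the difference of two transported vectors, which has the form
  \<open>(mat 1 - \<sigma> \<gamma>) *v z\<close> for the gain \<open>\<gamma>\<close> of a closed
  walk.\<close>

lemma switch_edge_gen:
  assumes e: "e \<in> X"
  shows "switch (edge_gen e y) \<in> fs.span (\<Union>v\<in>end_verts G X. at_vertex v ` local_gens v)"
    (is "_ \<in> ?P")
proof -
  define t where "t = tail G e"
  define h where "h = head G e"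
  define r where "r = root t"
  have V: "t \<in> end_verts G X" "h \<in> end_verts G X"
    using e by (auto simp: end_verts_def t_def h_def)
  have rh: "root h = r" using root_head[OF e] by (simp add: r_def t_def h_def)
  have pe: "\<psi> e \<in> carrier \<Gamma>" using psi_X e by auto
  \<comment> \<open>The gain of the closed walk that follows the path to \<open>t\<close>, crosses
    \<open>e\<close> and returns from \<open>h\<close> along the reversed path.\<close>
  define \<gamma> where "\<gamma> = gain_to t \<otimes> \<psi> e \<otimes> inv (gain_to h)"
  define q where "q = rev (map (\<lambda>(e, b). (e, \<not> b)) (path h))"
  have t: "is_walk G X r (path t) t" using path(1)[of t] by (simp add: r_def)
  have h: "is_walk G X r (path h) h" using path(1)[of h] by (simp add: rh)
  have te: "is_walk G X r (path t @ [(e, True)]) h"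
    using t e by (auto simp: is_walk_append t_def h_def)
  have q: "is_walk G X h q r" unfolding q_def by (rule is_walk_rev[OF h])
  have "is_walk G X t [(e, True)] h" using e by (simp add: t_def h_def)
  note walk_gain_append[OF group_axioms psi_X t this]
    walk_gain_append[OF group_axioms psi_X te q] walk_gain_rev[OF group_axioms psi_X h]
  then have "\<gamma> = walk_gain \<Gamma> \<psi> ((path t @ [(e, True)]) @ q)"
    using pe by (simp add: \<gamma>_def gain_to_def q_def)
  moreover have "is_walk G X r ((path t @ [(e, True)]) @ q) r"
    unfolding is_walk_append[of G X r "path t @ [(e, True)]"] using te q by blast
  ultimately have \<gamma>: "\<gamma> \<in> gain_group \<Gamma> G \<psi> X r"
    by (auto simp: gain_group_def)
  have "\<gamma> \<otimes> gain_to h = gain_to t \<otimes> \<psi> e"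
    using pe gain_to_carrier by (simp add: \<gamma>_def m_assoc)
  moreover have "\<gamma> \<in> carrier \<Gamma>" using pe gain_to_carrier by (simp add: \<gamma>_def)
  ultimately have "\<sigma> \<gamma> ** \<sigma> (gain_to h) = \<sigma> (gain_to t) ** \<sigma> (\<psi> e)"
    using pe gain_to_carrier by (metis sigma_mult)
  then have "\<sigma> \<gamma> *v (\<sigma> (gain_to h) *v y) = \<sigma> (gain_to t) *v (\<sigma> (\<psi> e) *v y)"
    by (simp only: matrix_vector_mul_assoc)
  then have "(mat 1 - \<sigma> \<gamma>) *v (\<sigma> (gain_to h) *v y) =
      \<sigma> (gain_to h) *v y - \<sigma> (gain_to t) *v (\<sigma> (\<psi> e) *v y)"
    by (simp only: matrix_vector_mult_diff_rdistrib matrix_vector_mul_lid)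
  then have eq: "switch (edge_gen e y) =
      at_vertex r ((mat 1 - \<sigma> \<gamma>) *v (\<sigma> (gain_to h) *v y)) +
      ((if root h = h then 0 else at_vertex h y) -
       (if root t = t then 0 else at_vertex t (\<sigma> (\<psi> e) *v y)))"
    unfolding edge_gen_def edge_map_def t_def[symmetric] h_def[symmetric]
    using V rh by (simp only: switch.diff switch_at_vertex r_def[symmetric] at_vertex_diff)
      (simp add: algebra_simps)
  have "r \<in> end_verts G X" "root r = r" using V root_in_end_verts by (auto simp: r_def)
  then have "at_vertex r ((mat 1 - \<sigma> \<gamma>) *v (\<sigma> (gain_to h) *v y)) \<in> ?P"
    using \<gamma> by (intro fs.span_base UN_I[of r] imageI) (auto simp: local_gens_def)
  moreover have "(if root v = v then 0 else at_vertex v z) \<in> ?P" if "v \<in> end_verts G X" for v z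
  proof (cases "root v = v")
    case False
    then show ?thesis using that by (auto simp: local_gens_def intro!: fs.span_base)
  qed (simp add: fs.span_zero)
  ultimately show ?thesis
    unfolding eq using V by (intro fs.span_add fs.span_diff) auto
qed

text \<open>The preimage is the vector of a walk: a closed walk at a root, and the chosen path from
  the root for any other vertex. In the latter case \<open>switch\<close> moves both ends to the
  root, where they cancel, leaving \<open>y\<close> at \<open>v\<close>.\<close>

lemma local_gens_in_switch_image:
  assumes v: "v \<in> end_verts G X" and y: "y \<in> local_gens v"
  shows "at_vertex v y \<in> switch ` edge_space X"
proof (cases "root v = v")
  case True
  then obtain \<gamma> z where \<gamma>: "\<gamma> \<in> gain_group \<Gamma> G \<psi> X v" and y: "y = (mat 1 - \<sigma> \<gamma>) *v z"
    using y by (auto simp: local_gens_def)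
  then obtain p where p: "is_walk G X v p v" "\<gamma> = walk_gain \<Gamma> \<psi> p"
    by (auto simp: gain_group_def)
  have "at_vertex v y = edge_map (\<sigma> \<gamma>) v v z"
    by (simp add: y edge_map_def matrix_vector_mult_diff_rdistrib at_vertex_diff)
  then have "at_vertex v y \<in> edge_space X"
    using walk_in_edge_space[OF p(1)] p(2) by simp
  moreover have "switch (at_vertex v y) = at_vertex v y"
    using True v by (simp add: switch_at_vertex gain_to_root sigma_one)
  ultimately show ?thesis by (metis imageI)
next
  case False
  have r: "root v \<in> end_verts G X" using v by (rule root_in_end_verts)
  have "edge_map (\<sigma> (gain_to v)) (root v) v y \<in> edge_space X"
    unfolding gain_to_def by (rule walk_in_edge_space[OF path(1)])
  moreover have "switch (edge_map (\<sigma> (gain_to v)) (root v) v y) = at_vertex v y"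
    using False v r
    by (simp only: edge_map_def switch.diff switch_at_vertex root_root gain_to_root sigma_one) simp
  ultimately show ?thesis by (metis imageI)
qed

lemma dim_edge_space_sum:
  "fs.dim (edge_space X) = (\<Sum>v\<in>end_verts G X. vec.dim (local_gens v))"
proof -
  let ?L = "\<Union>v\<in>end_verts G X. at_vertex v ` local_gens v"
  have "switch ` edge_space X = fs.span ?L"
  proof
    have "switch ` (\<Union>e\<in>X. range (edge_gen e)) \<subseteq> fs.span ?L"
      using switch_edge_gen by auto
    then show "switch ` edge_space X \<subseteq> fs.span ?L"
      unfolding edge_space_def switch.span_image[symmetric]
      by (intro fs.span_minimal fs.subspace_span)
    have "fs.subspace (switch ` edge_space X)"
      unfolding edge_space_def by (intro switch.subspace_image fs.subspace_span)
    then show "fs.span ?L \<subseteq> switch ` edge_space X"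
      using local_gens_in_switch_image by (intro fs.span_minimal) auto
  qed
  then have "fs.dim (edge_space X) = fs.dim ?L"
    using vector_space_pair.dim_injective_image[OF vector_space_pair.intro[OF vector_space_fun_scale
          vector_space_fun_scale] linear_switch inj_switch, of "edge_space X"] by simp
  then show ?thesis by (simp add: dim_at_vertex_Union finite_end_verts)
qed

text \<open>A vertex of \<open>X\<close> outside the set of roots has the full factor of dimension
  \<open>CARD('d)\<close>, and a root has a factor of dimension \<open>rep_dim\<close>. Roots stand
  for components here.\<close>

lemma dim_edge_space_roots:
  "int (fs.dim (edge_space X)) =
     int CARD('d) * int (card (end_verts G X)) - int CARD('d) * int (card (root ` end_verts G X))
     + (\<Sum>r\<in>root ` end_verts G X. int (rep_dim \<rho> (gain_group \<Gamma> G \<psi> X r)))"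
proof -
  let ?V = "end_verts G X"
  have sub: "root ` ?V \<subseteq> ?V" using root_in_end_verts by auto
  have "(\<Sum>v\<in>?V. vec.dim (local_gens v)) =
      (\<Sum>v\<in>?V - root ` ?V. vec.dim (local_gens v)) + (\<Sum>v\<in>root ` ?V. vec.dim (local_gens v))"
    using sum.subset_diff[OF sub finite_end_verts] .
  also have "(\<Sum>v\<in>?V - root ` ?V. vec.dim (local_gens v)) = (\<Sum>v\<in>?V - root ` ?V. CARD('d))"
    by (intro sum.cong refl) (auto simp: local_gens_def card_cart_basis, metis imageI)
  also have "(\<Sum>v\<in>root ` ?V. vec.dim (local_gens v)) =
      (\<Sum>v\<in>root ` ?V. rep_dim \<rho> (gain_group \<Gamma> G \<psi> X v))"
    by (intro sum.cong refl) (auto simp: local_gens_def \<sigma>_def rep_dim_extension[OF ext])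
  finally have "fs.dim (edge_space X) = card (?V - root ` ?V) * CARD('d) +
      (\<Sum>v\<in>root ` ?V. rep_dim \<rho> (gain_group \<Gamma> G \<psi> X v))"
    by (simp add: dim_edge_space_sum)
  moreover have "int (card (?V - root ` ?V)) = int (card ?V) - int (card (root ` ?V))"
    using sub finite_end_verts card_mono[OF finite_end_verts sub]
    by (simp add: card_Diff_subset finite_subset of_nat_diff)
  ultimately show ?thesis
    by (simp only: of_nat_add of_nat_mult of_nat_sum) (simp add: algebra_simps)
qed

section \<open>Edge components and their roots\<close>

definition component :: "'v \<Rightarrow> 'e set" where
  "component r = {e \<in> X. root (tail G e) = r}"

text \<open>Two vertices are joined by a walk exactly if their roots agree, so the vertex classes
  are the fibres of \<open>root\<close>. Both ends of an edge lie in the same fibre, which is why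
  \<open>component\<close> tests the tail only.\<close>

lemma edge_components_eq: "edge_components G X = component ` root ` end_verts G X"
proof -
  let ?V = "end_verts G X"
  let ?R = "{(u, w). u \<in> ?V \<and> w \<in> ?V \<and> (\<exists>p. is_walk G X u p w)}"
  have "?R `` {v} = {w \<in> ?V. root w = root v}" if "v \<in> ?V" for v
    using that unfolding root_eq_iff_walk[symmetric] by auto
  then have "vertex_components G X = (\<lambda>v. {w \<in> ?V. root w = root v}) ` ?V"
    unfolding vertex_components_def quotient_def by auto
  moreover have "{e \<in> X. tail G e \<in> {w \<in> ?V. root w = root v} \<and>
        head G e \<in> {w \<in> ?V. root w = root v}}
      = component (root v)" for v
    using root_head by (auto simp: component_def end_verts_def)
  moreover have "edge_components G X =
      (\<lambda>K. {e \<in> X. tail G e \<in> K \<and> head G e \<in> K}) ` vertex_components G X"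
    by (auto simp: edge_components_def)
  ultimately show ?thesis by (simp only: image_image)
qed

lemma root_in_component: "r \<in> root ` end_verts G X \<Longrightarrow> r \<in> end_verts G (component r)"
proof -
  assume r: "r \<in> root ` end_verts G X"
  then have "root r = r" "r \<in> end_verts G X" using root_in_end_verts by auto
  then show ?thesis using root_head by (auto simp: end_verts_def component_def)
qed

lemma root_end_verts_component: "v \<in> end_verts G (component r) \<Longrightarrow> root v = r"
  using root_head by (auto simp: end_verts_def component_def)

text \<open>A component contains an edge at its root and so determines it. This turns sums and
  cardinalities over components into ones over roots.\<close>

lemma inj_on_component: "inj_on component (root ` end_verts G X)"
proof (rule inj_onI)
  fix r s assume r: "r \<in> root ` end_verts G X" and s: "s \<in> root ` end_verts G X"
    and eq: "component r = component s"
  have "r \<in> end_verts G (component s)" using root_in_component[OF r] eq by simp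
  then have "root r = s" by (rule root_end_verts_component)
  with r show "r = s" by auto
qed

text \<open>A walk never leaves the component in which it starts, so gain groups may be computed in
  \<open>X\<close> or in the component alike.\<close>

lemma is_walk_component: "is_walk G X u p w \<longleftrightarrow> is_walk G (component (root u)) u p w"
proof
  assume "is_walk G X u p w"
  then show "is_walk G (component (root u)) u p w"
  proof (induction p arbitrary: u)
    case (Cons s p)
    obtain e b where s: "s = (e, b)" by (cases s)
    have e: "e \<in> X" using Cons.prems s by simp
    then have "root (step_src G s) = root (tail G e)" "root (step_dst G s) = root (tail G e)"
      using root_head s by auto
    moreover have "step_src G s = u" "is_walk G X (step_dst G s) p w" using Cons.prems by auto
    ultimately show ?case
      using Cons.IH[of "step_dst G s"] e s by (simp add: component_def del: step_src.simps step_dst.simps)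
  qed simp
next
  assume "is_walk G (component (root u)) u p w"
  then show "is_walk G X u p w" by (rule is_walk_mono) (auto simp: component_def)
qed

text \<open>Connectedness of the component allows the arbitrary base vertex of
  \<open>conn_rep_dim\<close> to be moved to the root.\<close>

lemma conn_rep_dim_component:
  assumes r: "r \<in> root ` end_verts G X"
  shows "conn_rep_dim \<Gamma> \<rho> G \<psi> (component r) = rep_dim \<rho> (gain_group \<Gamma> G \<psi> X r)"
proof -
  have "\<exists>p. is_walk G (component r) u p w"
    if "u \<in> end_verts G (component r)" "w \<in> end_verts G (component r)" for u w
    using that root_end_verts_component root_eq_iff_walk is_walk_component by metis
  moreover have "\<psi> \<in> component r \<rightarrow> carrier \<Gamma>" using psi_X by (auto simp: component_def)
  ultimately have "conn_rep_dim \<Gamma> \<rho> G \<psi> (component r) =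
      rep_dim \<rho> (gain_group \<Gamma> G \<psi> (component r) r)"
    using root_in_component[OF r] rho by (intro conn_rep_dim_eq group_axioms) auto
  also have "gain_group \<Gamma> G \<psi> (component r) r = gain_group \<Gamma> G \<psi> X r"
    using is_walk_component[of r] r by (auto simp: gain_group_def)
  finally show ?thesis .
qed

lemma dim_edge_space: "int (fs.dim (edge_space X)) = f_rho \<Gamma> \<rho> G \<psi> X"
  unfolding dim_edge_space_roots f_rho_def edge_components_eq
  by (simp add: card_image[OF inj_on_component] sum.reindex[OF inj_on_component] conn_rep_dim_component)

end

section \<open>The rank of the generic edge vectors\<close>

lemma edge_space_eq_span_axes:
  "edge_space X = fs.span (\<Union>e\<in>X. range (\<lambda>i. edge_gen e (axis i 1)))"
proof -
  have "edge_gen e y \<in> fs.span (\<Union>e\<in>X. range (\<lambda>i. edge_gen e (axis i 1)))" if "e \<in> X" for e y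
    by (subst edge_gen_expansion, intro fs.span_sum fs.span_scale fs.span_base) (use that in auto)
  moreover have "(\<Union>e\<in>X. range (\<lambda>i. edge_gen e (axis i 1))) \<subseteq> (\<Union>e\<in>X. range (edge_gen e))"
    by auto
  then have "(\<Union>e\<in>X. range (\<lambda>i. edge_gen e (axis i 1))) \<subseteq> fs.span (\<Union>e\<in>X. range (edge_gen e))"
    using fs.span_superset by blast
  ultimately show ?thesis
    unfolding edge_space_def fs.span_eq by auto
qed

text \<open>Meant for the ring of polynomial values that avoid the coordinates of one
  \<open>\<alpha> e\<close>: it contains the coordinates of the vectors of all other edges, and of
  the images of the axis vectors under \<open>edge_gen e\<close>.\<close>

lemma edge_gen_vectors_over:
  assumes "field_subring R" "range \<iota> \<subseteq> R" "e \<in> arcs G" "\<And>i. y $ i \<in> R"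
  shows "edge_gen e y \<in> vectors_over (verts G) R"
proof -
  interpret fin_digraph G by (rule fin)
  interpret field_subring R by fact
  have "(\<sigma> \<gamma> *v y) $ i \<in> R" for \<gamma> i
    unfolding matrix_vector_mult_def \<sigma>_def using assms by (auto intro!: sum mult)
  then show ?thesis
    using assms zero
    by (auto simp: vectors_over_def edge_gen_def edge_map_def at_vertex_apply intro!: diff uminus)
qed

lemma dim_edge_vecs:
  assumes indep: "algebraically_independent \<iota> (arcs G \<times> UNIV) (\<lambda>(e, i). \<alpha> e $ i)"
    and F: "F \<subseteq> arcs G"
  shows "int (fs.dim (edge_vec \<iota> \<rho> G \<psi> \<alpha> ` F)) = f_rho_1 \<Gamma> \<rho> G \<psi> F"
proof -
  interpret fin_digraph G by (rule fin)
  let ?x = "edge_vec \<iota> \<rho> G \<psi> \<alpha>"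
  \<comment> \<open>A finite generating set in place of the whole subspace, since the rank lemmas
    ask for finite sets.\<close>
  define U where "U e = range (\<lambda>i. edge_gen e (axis i 1))" for e
  have finU: "finite (U e)" for e by (simp add: U_def)
  have dimU: "int (fs.dim (\<Union>(U ` X))) = f_rho \<Gamma> \<rho> G \<psi> X" if "X \<subseteq> F" for X
    using dim_edge_space[of X] that F by (simp add: U_def edge_space_eq_span_axes)
  have mem: "?x e \<in> fs.span (U e)" for e
    unfolding edge_vec_eq_edge_gen
    by (subst edge_gen_expansion, intro fs.span_sum fs.span_scale fs.span_base) (auto simp: U_def)
  \<comment> \<open>The vector of \<open>e\<close> is the combination of the vectors
    \<open>edge_gen e (axis i 1)\<close> with the coordinates of \<open>\<alpha> e\<close> as
    coefficients, while the vectors of \<open>S\<close> are defined over a ring without these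
    coordinates.\<close>
  have generic: "U e \<subseteq> fs.span (?x ` S)"
    if e: "e \<in> arcs G" and S: "S \<subseteq> arcs G - {e}" and "?x e \<in> fs.span (?x ` S)" for e S
  proof -
    define R where "R = poly_values \<iota> ((arcs G - {e}) \<times> UNIV) (\<lambda>(e, i). \<alpha> e $ i)"
    have R: "field_subring R" unfolding R_def by (rule field_subring_poly_values[OF ext])
    have \<iota>: "range \<iota> \<subseteq> R" unfolding R_def using poly_values_const[OF ext] by auto
    have "\<alpha> e' $ i \<in> R" if "e' \<in> S" for e' i
      using poly_values_var[OF ext, of "(e', i)" "(arcs G - {e}) \<times> UNIV" "\<lambda>(e, i). \<alpha> e $ i"] that S
      by (auto simp: R_def)
    then have x: "?x ` S \<subseteq> vectors_over (verts G) R"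
      using S edge_gen_vectors_over[OF R \<iota>] by (auto simp: edge_vec_eq_edge_gen)
    have "(axis i 1 :: 'k ^ 'd) $ j \<in> R" for i j
      using field_subring.one[OF R] field_subring.zero[OF R] by (simp add: axis_def)
    then have u: "edge_gen e (axis i 1) \<in> vectors_over (verts G) R" for i
      using e by (intro edge_gen_vectors_over[OF R \<iota>])
    have "finite (?x ` S)" using S finite_arcs by (meson finite_Diff finite_imageI finite_subset)
    moreover have "(\<Sum>i\<in>UNIV. fun_scale (\<alpha> e $ i) (edge_gen e (axis i 1))) \<in> fs.span (?x ` S)"
      using that(3) unfolding edge_vec_eq_edge_gen edge_gen_expansion[symmetric] .
    ultimately have "edge_gen e (axis i 1) \<in> fs.span (?x ` S)" for i
      using generic_combination_in_span[where u = "\<lambda>i. edge_gen e (axis i 1)",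
          OF ext indep e finite_verts _ R_def x u] by blast
    then show ?thesis by (auto simp: U_def)
  qed
  have finF: "finite F" using F finite_arcs by (rule finite_subset)
  show ?thesis
    unfolding f_rho_1_def
  proof (rule Min_eqI[symmetric])
    have "{int (card (F - X)) + f_rho \<Gamma> \<rho> G \<psi> X | X. X \<subseteq> F} =
        (\<lambda>X. int (card (F - X)) + f_rho \<Gamma> \<rho> G \<psi> X) ` Pow F" by auto
    then show "finite {int (card (F - X)) + f_rho \<Gamma> \<rho> G \<psi> X | X. X \<subseteq> F}"
      using finF by simp
  next
    fix n assume "n \<in> {int (card (F - X)) + f_rho \<Gamma> \<rho> G \<psi> X | X. X \<subseteq> F}"
    then obtain X where X: "X \<subseteq> F" "n = int (card (F - X)) + f_rho \<Gamma> \<rho> G \<psi> X" by auto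
    have "fs.dim (?x ` F) \<le> card (F - X) + fs.dim (\<Union>(U ` X))"
      by (rule fs.rank_le_subspace_bound[OF finite_arcs finU mem F X(1)])
    then show "int (fs.dim (?x ` F)) \<le> n" using X(2) dimU[OF X(1)] by linarith
  next
    have "\<exists>X\<subseteq>F. card (F - X) + fs.dim (\<Union>(U ` X)) \<le> fs.dim (?x ` F)"
      by (rule fs.subspace_bound_attained[OF finite_arcs finU generic F])
    then obtain X where X: "X \<subseteq> F"
        "card (F - X) + fs.dim (\<Union>(U ` X)) \<le> fs.dim (?x ` F)" by auto
    \<comment> \<open>Together with the bound valid for every \<open>X\<close>, the inequality just
      obtained becomes an equality, so the minimum is attained.\<close>
    have "fs.dim (?x ` F) \<le> card (F - X) + fs.dim (\<Union>(U ` X))"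
      by (rule fs.rank_le_subspace_bound[OF finite_arcs finU mem F X(1)])
    with X have "int (fs.dim (?x ` F)) = int (card (F - X)) + f_rho \<Gamma> \<rho> G \<psi> X"
      using dimU[OF X(1)] by linarith
    with X(1) show "int (fs.dim (?x ` F)) \<in> {int (card (F - X)) + f_rho \<Gamma> \<rho> G \<psi> X | X. X \<subseteq> F}"
      by blast
  qed
qed

end

theorem theorem5p4:
  fixes \<Gamma> :: "('g, 'm) monoid_scheme"
    and \<rho> :: "'g \<Rightarrow> 'f::field ^ 'd ^ 'd"
    and G :: "('v, 'e) pre_digraph"
    and \<psi> :: "'e \<Rightarrow> 'g"
    and \<iota> :: "'f \<Rightarrow> 'k::field"
    and \<alpha> :: "'e \<Rightarrow> 'k ^ 'd"
  assumes "group \<Gamma>"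
    and "\<rho> \<in> hom \<Gamma> GL"
    and "fin_digraph G"
    and "\<psi> \<in> arcs G \<rightarrow> carrier \<Gamma>"
    and "field_extension \<iota>"
    and "algebraically_independent \<iota> (arcs G \<times> UNIV) (\<lambda>(e, i). \<alpha> e $ i)"
  shows "\<forall>F \<subseteq> arcs G.
    int (family_rank (edge_vec \<iota> \<rho> G \<psi> \<alpha>) F) = f_rho_1 \<Gamma> \<rho> G \<psi> F \<and>
    int (matroid_rank (family_independent (edge_vec \<iota> \<rho> G \<psi> \<alpha>)) F) = f_rho_1 \<Gamma> \<rho> G \<psi> F"
proof (intro allI impI)
  fix F assume F: "F \<subseteq> arcs G"
  interpret gain_representation \<Gamma> \<rho> G \<psi> \<iota>
    using assms by (simp add: gain_representation_def gain_representation_axioms_def)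
  interpret fin_digraph G by fact
  let ?x = "edge_vec \<iota> \<rho> G \<psi> \<alpha>"
  have "family_rank ?x F = fs.dim (?x ` F)"
    by (simp add: family_rank_def)
  moreover have "matroid_rank (family_independent ?x) F = fs.dim (?x ` F)"
    unfolding matroid_rank_def family_independent_def
    using F finite_arcs by (intro fs.Max_card_independent_subfamily) (rule finite_subset)
  ultimately show "int (family_rank ?x F) = f_rho_1 \<Gamma> \<rho> G \<psi> F \<and>
      int (matroid_rank (family_independent ?x) F) = f_rho_1 \<Gamma> \<rho> G \<psi> F"
    using dim_edge_vecs[OF assms(6) F] by simp
qed

end
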